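(* Let $P$ be a Cohen--Macaulay finite graded bounded poset of rank $r\ge1$. Then the $\chi$-Chow polynomial of $P$ is $\gamma$-positive: there are integers $\gamma_i\ge0$ with $\mathrm{H}_P(x)=\sum_{i=0}^{\lfloor(r-1)/2\rfloor}\gamma_i\,x^i(1+x)^{r-1-2i}$.
   Context: For a finite graded bounded poset $P$ with rank function $\rho$ ($\rho_{st}=\rho(t)-\rho(s)$, rank $r=\rho(\widehat1)$), the characteristic function is $\chi_{st}(x)=\sum_{s\le w\le t}\mu_{sw}x^{\rho_{wt}}$ (Möbius function $\mu$), an element of the incidence algebra (maps $[s,t]\mapsto a_{st}(x)\in\mathbb{Z}[x]$ with product $(ab)_{st}=\sum_{s\le w\le t}a_{sw}b_{wt}$). For $s<t$, $\chi_{st}$ is divisible by $x-1$; let $\overline{\chi}_{st}=\chi_{st}/(x-1)$ for $s<t$ and $\overline{\chi}_{ss}=-1$. The $\chi$-Chow function is $\mathrm{H}=-(\overline{\chi})^{-1}$ and $\mathrm{H}_P=\mathrm{H}_{\widehat0\widehat1}$. $P$ is Cohen--Macaulay (over $\mathbb{Q}$) if for every $s<t$ the order complex of the open interval $(s,t)=\{w:s<w<t\}$ has rational reduced homology $\widetilde H_i=0$ for all $i\ne\rho_{st}-2$. *)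

theory Defs
  imports
    "HOL-Algebra.Ring"
    "HOL-Computational_Algebra.Polynomial"
begin

text \<open>Posets are carrier sets \<open>P\<close> in an ordered type, with the induced order.\<close>

definition poset_covers :: "'a::order set \<Rightarrow> 'a \<Rightarrow> 'a \<Rightarrow> bool" where
  "poset_covers P s t \<longleftrightarrow>
     s \<in> P \<and> t \<in> P \<and> s < t \<and> \<not> (\<exists>w\<in>P. s < w \<and> w < t)"

locale finite_graded_bounded_poset =
  fixes P :: "'a::order set" and bt tp :: 'a and rk :: "'a \<Rightarrow> nat"
  assumes finite_carrier: "finite P"
    and bt_in: "bt \<in> P" and tp_in: "tp \<in> P"
    and bt_le: "\<And>x. x \<in> P \<Longrightarrow> bt \<le> x"
    and le_tp: "\<And>x. x \<in> P \<Longrightarrow> x \<le> tp"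
    and rk_bt: "rk bt = 0"
    and rk_covers: "\<And>s t. poset_covers P s t \<Longrightarrow> rk t = Suc (rk s)"


section \<open>Incidence algebra and Chow function\<close>

text \<open>
  A family indexed by the intervals of \<open>P\<close> is a function of two arguments that vanishes
  on all pairs that are not the endpoints of an interval.
\<close>

definition incidence_algebra :: "'a::order set \<Rightarrow> ('a \<Rightarrow> 'a \<Rightarrow> int poly) ring" where
  "incidence_algebra P =
     \<lparr>carrier = {a. \<forall>s t. \<not> (s \<in> P \<and> t \<in> P \<and> s \<le> t) \<longrightarrow> a s t = 0},
      monoid.mult = (\<lambda>a b s t. \<Sum>w\<in>{w \<in> P. s \<le> w \<and> w \<le> t}. a s w * b w t),
      one = (\<lambda>s t. if s \<in> P \<and> s = t then 1 else 0),
      zero = (\<lambda>s t. 0),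
      add = (\<lambda>a b s t. a s t + b s t)\<rparr>"

definition zeta_function :: "'a::order set \<Rightarrow> 'a \<Rightarrow> 'a \<Rightarrow> int poly" where
  "zeta_function P = (\<lambda>s t. if s \<in> P \<and> t \<in> P \<and> s \<le> t then 1 else 0)"

text \<open>The integers \<open>\<mu>\<^sub>s\<^sub>t\<close> are regarded as constant polynomials.\<close>

definition moebius_function :: "'a::order set \<Rightarrow> 'a \<Rightarrow> 'a \<Rightarrow> int poly" where
  "moebius_function P = inv\<^bsub>incidence_algebra P\<^esub> (zeta_function P)"

definition char_function :: "'a::order set \<Rightarrow> ('a \<Rightarrow> nat) \<Rightarrow> 'a \<Rightarrow> 'a \<Rightarrow> int poly" where
  "char_function P rk = (\<lambda>s t. if s \<in> P \<and> t \<in> P \<and> s \<le> t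
     then \<Sum>w\<in>{w \<in> P. s \<le> w \<and> w \<le> t}. moebius_function P s w * monom 1 (rk t - rk w)
     else 0)"

text \<open>The division by \<open>x - 1\<close> is exact in a graded poset.\<close>

definition reduced_char_function ::
    "'a::order set \<Rightarrow> ('a \<Rightarrow> nat) \<Rightarrow> 'a \<Rightarrow> 'a \<Rightarrow> int poly" where
  "reduced_char_function P rk = (\<lambda>s t.
     if s \<in> P \<and> t \<in> P \<and> s < t then char_function P rk s t div [:-1, 1:]
     else if s \<in> P \<and> s = t then -1
     else 0)"

definition chow_function :: "'a::order set \<Rightarrow> ('a \<Rightarrow> nat) \<Rightarrow> 'a \<Rightarrow> 'a \<Rightarrow> int poly" where
  "chow_function P rk =
     \<ominus>\<^bsub>incidence_algebra P\<^esub> (inv\<^bsub>incidence_algebra P\<^esub> (reduced_char_function P rk))"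


section \<open>Rational reduced homology of the order complex\<close>

text \<open>
  A simplex of dimension \<open>i\<close> of the order complex of \<open>X\<close> is a chain \<open>x\<^sub>0 < \<dots> < x\<^sub>i\<close>,
  represented (and oriented) by the increasing list of its elements.  The empty list is the
  simplex of dimension \<open>-1\<close>, so the resulting chain complex is the augmented one.
\<close>

definition order_simplices :: "'a::order set \<Rightarrow> int \<Rightarrow> 'a list set" where
  "order_simplices X i = {c. set c \<subseteq> X \<and> sorted_wrt (<) c \<and> int (length c) = i + 1}"

definition simplicial_chains :: "'a::order set \<Rightarrow> int \<Rightarrow> ('a list \<Rightarrow> rat) set" where
  "simplicial_chains X i = {f. \<forall>c. c \<notin> order_simplices X i \<longrightarrow> f c = 0}"

text \<open>
  The linear extension, for finite \<open>X\<close>, of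
  \<open>[x\<^sub>0, \<dots>, x\<^sub>i] \<mapsto> \<Sum>j. (-1)^j [x\<^sub>0, \<dots>, x\<^sub>j\<^sub>-\<^sub>1, x\<^sub>j\<^sub>+\<^sub>1, \<dots>, x\<^sub>i]\<close>.
\<close>

definition boundary_map ::
    "'a::order set \<Rightarrow> int \<Rightarrow> ('a list \<Rightarrow> rat) \<Rightarrow> 'a list \<Rightarrow> rat" where
  "boundary_map X i f = (\<lambda>d. \<Sum>c\<in>order_simplices X i. \<Sum>j<length c.
     if take j c @ drop (Suc j) c = d then (-1) ^ j * f c else 0)"

definition simplicial_cycles :: "'a::order set \<Rightarrow> int \<Rightarrow> ('a list \<Rightarrow> rat) set" where
  "simplicial_cycles X i = {f \<in> simplicial_chains X i. boundary_map X i f = (\<lambda>d. 0)}"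

definition simplicial_boundaries :: "'a::order set \<Rightarrow> int \<Rightarrow> ('a list \<Rightarrow> rat) set" where
  "simplicial_boundaries X i = boundary_map X (i + 1) ` simplicial_chains X (i + 1)"

definition reduced_homology :: "'a::order set \<Rightarrow> int \<Rightarrow> ('a list \<Rightarrow> rat) set set" where
  "reduced_homology X i = simplicial_cycles X i //
     {(z, w). z \<in> simplicial_cycles X i \<and> w \<in> simplicial_cycles X i \<and>
        (\<lambda>c. z c - w c) \<in> simplicial_boundaries X i}"

text \<open>The zero element of the quotient is the class formed by the boundaries.\<close>

definition cohen_macaulay :: "'a::order set \<Rightarrow> ('a \<Rightarrow> nat) \<Rightarrow> bool" where
  "cohen_macaulay P rk \<longleftrightarrow>
     (\<forall>s\<in>P. \<forall>t\<in>P. s < t \<longrightarrow>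
        (\<forall>i. i \<noteq> (int (rk t) - int (rk s)) - 2 \<longrightarrow>
           reduced_homology {w \<in> P. s < w \<and> w < t} i =
             {simplicial_boundaries {w \<in> P. s < w \<and> w < t} i}))"

end

theory Submission
  imports Defs "HOL-Library.Function_Algebras"
begin

text \<open>
  Cancelling the Moebius function from \<open>H = - \<chi>bar\<^sup>-\<^sup>1\<close> expresses \<open>H\<^sub>P\<close> as a sum over chains, where a
  chain with rank set \<open>S\<close> has as weight the product of \<open>x + \<dots> + x^(d-1)\<close> over the gaps \<open>d\<close> of \<open>S\<close>.
  In terms of the flag h-vector this becomes \<open>H\<^sub>P = \<Sum>T. h\<^sub>T V\<^sub>T\<close>, where \<open>V\<^sub>T\<close> sums the weights over the
  supersets of \<open>T\<close>. A recursion along the ranks shows that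
  \<open>V\<^sub>T = x^card T * (1 + x)^(r - 1 - 2 * card T)\<close> if \<open>T\<close> contains neither \<open>1\<close> nor two consecutive
  ranks, and \<open>V\<^sub>T = 0\<close> otherwise. Thus \<open>\<gamma>\<^sub>i\<close> is a sum of numbers \<open>h\<^sub>T\<close>. Up to sign, \<open>h\<^sub>T\<close> is the
  reduced Euler characteristic of the rank selection of \<open>P\<close> at \<open>T\<close>. Rank selections of a
  Cohen--Macaulay poset only have homology in top degree, so \<open>h\<^sub>T\<close> is its dimension.
\<close>

section \<open>Chain complexes of order complexes\<close>

text \<open>The weights arise because the product of \<zeta> and \<chi>bar has the entry
  \<open>(x^d - x) / (x - 1)\<close> at rank difference \<open>d > 0\<close> and -1 on the diagonal.
  The difficulty is positivity: the flag h-vector is an alternating sum, while Cohen--Macaulayness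
  speaks only of full open intervals and not of rank selections. When a rank is deleted, the
  homology of what remains is controlled by the links of the deleted elements. Each link consists of
  a part below and a part above, which belong to other intervals, so the induction has to treat all
  intervals and all rank sets together and needs a Kuenneth argument for joins. Only vanishing below
  the top degree is propagated; this suffices for rank-nullity to turn an Euler characteristic into
  a dimension. Simplices are indexed by size instead of dimension: the empty simplex sits at size 0,
  and under joins the sizes simply add.\<close>

abbreviation order_chain :: "'a::order set \<Rightarrow> bool" where
  "order_chain \<equiv> Complete_Partial_Order.chain (\<le>)"

text \<open>The number of elements below \<open>y\<close> is the position of \<open>y\<close> in the
  increasing list of \<open>insert y S\<close>.\<close>

definition removal_sign :: "'a::order \<Rightarrow> 'a set \<Rightarrow> rat" where
  "removal_sign y S = (-1) ^ card {s \<in> S. s < y}"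

definition set_chains :: "'a::order set \<Rightarrow> nat \<Rightarrow> ('a set \<Rightarrow> rat) set" where
  "set_chains X k = {f. \<forall>S. f S \<noteq> 0 \<longrightarrow> S \<subseteq> X \<and> order_chain S \<and> card S = k}"

text \<open>Read coefficientwise: the value at \<open>S\<close> collects all simplices that become
  \<open>S\<close> when one vertex is deleted. The same formula serves all sizes.\<close>

definition set_boundary :: "'a::order set \<Rightarrow> ('a set \<Rightarrow> rat) \<Rightarrow> 'a set \<Rightarrow> rat" where
  "set_boundary X f S = (\<Sum>y\<in>X - S. removal_sign y S * f (insert y S))"

text \<open>Sizes \<open>k < n\<close> are the dimensions below \<open>n - 1\<close>. For an open
  interval of rank difference \<open>d\<close>, the choice \<open>n = d - 1\<close> leaves the top
  dimension \<open>d - 2\<close> free.\<close>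

definition acyclic_below :: "'a::order set \<Rightarrow> nat \<Rightarrow> bool" where
  "acyclic_below X n \<longleftrightarrow> (\<forall>k<n. \<forall>z\<in>set_chains X k. set_boundary X z = 0 \<longrightarrow>
     (\<exists>w\<in>set_chains X (Suc k). set_boundary X w = z))"

lemma order_chain_insert_comparable:
  "order_chain (insert y (insert z S)) \<Longrightarrow> y \<le> z \<or> z \<le> y"
  by (auto simp: Complete_Partial_Order.chain_def)

lemma order_chain_subset: "order_chain S \<Longrightarrow> T \<subseteq> S \<Longrightarrow> order_chain T"
  by (auto simp: Complete_Partial_Order.chain_def)

lemma order_chain_insert:
  "order_chain S \<Longrightarrow> (\<And>y. y \<in> S \<Longrightarrow> y \<le> x \<or> x \<le> y) \<Longrightarrow> order_chain (insert x S)"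
  unfolding Complete_Partial_Order.chain_def by blast

lemma set_chainsD:
  assumes "f \<in> set_chains X k" "f S \<noteq> 0"
  shows "S \<subseteq> X" "order_chain S" "card S = k"
  using assms by (auto simp: set_chains_def)

lemma set_chains_zero [simp]: "0 \<in> set_chains X k"
  by (auto simp: set_chains_def)

lemma set_chains_add: "f \<in> set_chains X k \<Longrightarrow> g \<in> set_chains X k \<Longrightarrow> f + g \<in> set_chains X k"
  unfolding set_chains_def by (simp, metis add.right_neutral)

lemma set_chains_diff: "f \<in> set_chains X k \<Longrightarrow> g \<in> set_chains X k \<Longrightarrow> f - g \<in> set_chains X k"
  unfolding set_chains_def by (simp, metis diff_zero)

lemma set_chains_mono: "X \<subseteq> Y \<Longrightarrow> set_chains X k \<subseteq> set_chains Y k"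
  by (fastforce simp: set_chains_def)

lemma set_boundary_zero [simp]: "set_boundary X 0 = 0"
  by (rule ext) (simp add: set_boundary_def)

lemma set_boundary_add: "set_boundary X (f + g) = set_boundary X f + set_boundary X g"
  by (rule ext) (simp add: set_boundary_def distrib_left sum.distrib)

lemma set_boundary_diff: "set_boundary X (f - g) = set_boundary X f - set_boundary X g"
  by (rule ext) (simp add: set_boundary_def right_diff_distrib sum_subtractf)

lemma set_boundary_not_subset:
  assumes "f \<in> set_chains X k" "\<not> S \<subseteq> X"
  shows "set_boundary Y f S = 0"
  unfolding set_boundary_def
proof (intro sum.neutral ballI)
  fix y assume "y \<in> Y - S"
  have "f (insert y S) = 0" using set_chainsD(1)[OF assms(1)] assms(2) by blast
  then show "removal_sign y S * f (insert y S) = 0" by simp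
qed

lemma set_boundary_mono:
  assumes "f \<in> set_chains X k" "X \<subseteq> Y" "finite Y"
  shows "set_boundary Y f = set_boundary X f"
proof
  fix S
  show "set_boundary Y f S = set_boundary X f S"
    unfolding set_boundary_def
  proof (rule sum.mono_neutral_right)
    show "\<forall>y\<in>(Y - S) - (X - S). removal_sign y S * f (insert y S) = 0"
      using set_chainsD(1)[OF assms(1)] by fastforce
  qed (use assms in auto)
qed

lemma set_boundary_in:
  assumes "f \<in> set_chains X (Suc k)" "finite X"
  shows "set_boundary X f \<in> set_chains X k"
  unfolding set_chains_def
proof (intro CollectI allI impI)
  fix S assume "set_boundary X f S \<noteq> 0"
  then obtain y where y: "y \<in> X - S" "f (insert y S) \<noteq> 0"
    unfolding set_boundary_def by (metis (no_types, lifting) mult_zero_right sum.neutral)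
  note D = set_chainsD[OF assms(1) y(2)]
  have "finite S" using finite_subset[OF D(1) assms(2)] by simp
  then show "S \<subseteq> X \<and> order_chain S \<and> card S = k"
    using D y order_chain_subset[OF D(2)] by auto
qed

lemma set_boundary_degree_zero:
  assumes "f \<in> set_chains X 0" "finite X"
  shows "set_boundary X f = 0"
proof
  fix S
  have "f (insert y S) = 0" for y
    using set_chainsD[OF assms(1), of "insert y S"] finite_subset[OF _ assms(2)] by (auto simp: card_eq_0_iff)
  then show "set_boundary X f S = 0 S" by (simp add: set_boundary_def)
qed

lemma removal_sign_insert:
  assumes "finite S" "y \<notin> S"
  shows "removal_sign z (insert y S) = (if y < z then -1 else 1) * removal_sign z S"
proof (cases "y < z")
  case True
  then have "{s \<in> insert y S. s < z} = insert y {s \<in> S. s < z}" by auto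
  with True assms show ?thesis by (simp add: removal_sign_def)
next
  case False
  then have "{s \<in> insert y S. s < z} = {s \<in> S. s < z}" by auto
  with False show ?thesis by (simp add: removal_sign_def)
qed

lemma removal_sign_square [simp]: "removal_sign y S * removal_sign y S = 1"
  by (simp add: removal_sign_def flip: power_mult_distrib)

lemma removal_sign_nonzero [simp]: "removal_sign y S \<noteq> 0"
  by (simp add: removal_sign_def)

text \<open>Adding \<open>y\<close> and \<open>z\<close> in either order gives the same set with
  opposite signs: members of a chain are comparable, so exactly one of the two shifts the position
  of the other. The sum over ordered pairs is thus its own negative.\<close>

lemma set_boundary_boundary:
  assumes f: "f \<in> set_chains X k" and fin: "finite X"
  shows "set_boundary X (set_boundary X f) = 0"
proof
  fix S
  let ?g = "\<lambda>y z. removal_sign y S * (removal_sign z (insert y S) * f (insert z (insert y S)))"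
  define I where "I = {p \<in> (X - S) \<times> (X - S). fst p \<noteq> snd p}"
  have fin': "finite (X - S)" using fin by simp
  have eq: "set_boundary X (set_boundary X f) S = (\<Sum>p\<in>I. ?g (fst p) (snd p))"
  proof -
    have "set_boundary X (set_boundary X f) S = (\<Sum>y\<in>X - S. \<Sum>z\<in>X - insert y S. ?g y z)"
      by (simp add: set_boundary_def sum_distrib_left)
    also have "\<dots> = (\<Sum>p\<in>Sigma (X - S) (\<lambda>y. X - insert y S). ?g (fst p) (snd p))"
      by (subst sum.Sigma) (use fin in \<open>auto simp: case_prod_beta\<close>)
    also have "Sigma (X - S) (\<lambda>y. X - insert y S) = I" by (auto simp: I_def)
    finally show ?thesis .
  qed
  have anti: "?g y z = - ?g z y" if "y \<in> X - S" "z \<in> X - S" "y \<noteq> z" for y z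
  proof (cases "f (insert y (insert z S)) = 0")
    case True
    then show ?thesis by (simp add: insert_commute)
  next
    case False
    note D = set_chainsD[OF f False]
    have "finite S" using finite_subset[OF D(1) fin] by simp
    moreover have "y < z \<or> z < y"
      using order_chain_insert_comparable[OF D(2)] that(3) by auto
    ultimately show ?thesis
      using that by (auto simp: removal_sign_insert insert_commute)
  qed
  have "(\<Sum>p\<in>I. ?g (fst p) (snd p)) = (\<Sum>p\<in>I. ?g (snd p) (fst p))"
    by (rule sum.reindex_bij_witness[of _ prod.swap prod.swap]) (auto simp: I_def)
  also have "\<dots> = (\<Sum>p\<in>I. - ?g (fst p) (snd p))"
    by (rule sum.cong[OF refl], rule anti) (auto simp: I_def)
  finally have "(\<Sum>p\<in>I. ?g (fst p) (snd p)) = 0" by (simp add: sum_negf)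
  with eq show "set_boundary X (set_boundary X f) S = 0 S" by simp
qed

lemma set_boundary_Un:
  assumes "finite A" "finite B" "A \<inter> B = {}"
  shows "set_boundary (A \<union> B) f S = set_boundary A f S + set_boundary B f S"
proof -
  have "(A \<union> B) - S = (A - S) \<union> (B - S)" by auto
  then show ?thesis unfolding set_boundary_def
    using assms by (simp only:, subst sum.union_disjoint) auto
qed

text \<open>The order complex of \<open>A \<union> B\<close> is the join of the order complexes of \<open>A\<close> and \<open>B\<close>.\<close>

locale poset_join =
  fixes A B :: "'a::order set"
  assumes fin_A: "finite A" and fin_B: "finite B"
    and below: "\<And>p q. p \<in> A \<Longrightarrow> q \<in> B \<Longrightarrow> p < q"
begin

lemma disjoint: "A \<inter> B = {}"
  using below by fastforce

lemma not_above: "p \<in> A \<Longrightarrow> q \<in> B \<Longrightarrow> \<not> q < p"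
  using below by (meson less_asym)

lemma removal_sign_lower:
  assumes "L \<subseteq> A" "U \<subseteq> B" "y \<in> A"
  shows "removal_sign y (L \<union> U) = removal_sign y L"
proof -
  have "{s \<in> L \<union> U. s < y} = {s \<in> L. s < y}"
    using assms not_above by blast
  then show ?thesis by (simp add: removal_sign_def)
qed

text \<open>All of \<open>L\<close> lies below an element of \<open>B\<close> and shifts its
  position by \<open>card L\<close>. This is the Koszul sign of a tensor product.\<close>

lemma removal_sign_upper:
  assumes "L \<subseteq> A" "U \<subseteq> B" "y \<in> B"
  shows "removal_sign y (L \<union> U) = (-1) ^ card L * removal_sign y U"
proof -
  have "{s \<in> L \<union> U. s < y} = L \<union> {s \<in> U. s < y}"
    using assms below by blast
  moreover have "finite L" "finite U" using assms fin_A fin_B finite_subset by auto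
  moreover have "L \<inter> {s \<in> U. s < y} = {}" using assms disjoint by blast
  ultimately show ?thesis
    by (simp add: removal_sign_def card_Un_disjoint power_add)
qed

lemma set_boundary_lower:
  assumes "L \<subseteq> A" "U \<subseteq> B"
  shows "set_boundary A f (L \<union> U) = (\<Sum>y\<in>A - L. removal_sign y L * f (insert y L \<union> U))"
proof -
  have "A - (L \<union> U) = A - L" using assms disjoint by blast
  then show ?thesis
    unfolding set_boundary_def using assms by (auto intro!: sum.cong simp: removal_sign_lower)
qed

lemma set_boundary_upper:
  assumes "L \<subseteq> A" "U \<subseteq> B"
  shows "set_boundary B f (L \<union> U) =
    (-1) ^ card L * (\<Sum>y\<in>B - U. removal_sign y U * f (L \<union> insert y U))"
proof -
  have "B - (L \<union> U) = B - U" using assms disjoint by blast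
  then show ?thesis
    unfolding set_boundary_def sum_distrib_left
    using assms by (auto intro!: sum.cong simp: removal_sign_upper)
qed

lemma set_boundary_split:
  assumes "L \<subseteq> A" "U \<subseteq> B"
  shows "set_boundary (A \<union> B) f (L \<union> U) =
    (\<Sum>y\<in>A - L. removal_sign y L * f (insert y L \<union> U)) +
    (-1) ^ card L * (\<Sum>y\<in>B - U. removal_sign y U * f (L \<union> insert y U))"
  using set_boundary_Un[OF fin_A fin_B disjoint] set_boundary_lower[OF assms] set_boundary_upper[OF assms]
  by simp

lemma card_split:
  assumes "L \<subseteq> A" "U \<subseteq> B"
  shows "card (L \<union> U) = card L + card U"
  using assms disjoint fin_A fin_B by (intro card_Un_disjoint) (auto intro: finite_subset)

lemma order_chain_split:
  assumes "L \<subseteq> A" "U \<subseteq> B" "order_chain L" "order_chain U"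
  shows "order_chain (L \<union> U)"
  unfolding Complete_Partial_Order.chain_def
proof (intro ballI)
  fix x y assume "x \<in> L \<union> U" "y \<in> L \<union> U"
  then consider "x \<in> L" "y \<in> L" | "x \<in> U" "y \<in> U" | "x \<in> A" "y \<in> B" | "y \<in> A" "x \<in> B"
    using assms by blast
  then show "x \<le> y \<or> y \<le> x"
    by cases (use assms below in \<open>auto simp: Complete_Partial_Order.chain_def less_imp_le\<close>)
qed

text \<open>The chains are filtered by \<open>card (S \<inter> B)\<close>. In the cycle equation one
  layer below \<open>q\<close>, the terms that add an element of \<open>A\<close> vanish, so for
  each \<open>L\<close> the coefficients in layer \<open>q\<close> form a cycle of \<open>B\<close>,
  which has a filling as \<open>q < b\<close>. The fillings live in layer \<open>q + 1\<close>, so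
  their boundary in the direction of \<open>A\<close> does not disturb layers up to
  \<open>q\<close>.\<close>

lemma eliminate_upper_degree:
  assumes u: "u \<in> set_chains (A \<union> B) k" and cyc: "set_boundary (A \<union> B) u = 0"
    and van: "\<And>S. card (S \<inter> B) < q \<Longrightarrow> u S = 0"
    and B: "acyclic_below B b" and q: "q < b"
  shows "\<exists>v\<in>set_chains (A \<union> B) (Suc k). \<forall>S. card (S \<inter> B) \<le> q \<longrightarrow> set_boundary (A \<union> B) v S = u S"
proof -
  define uu where "uu = (\<lambda>L U. if U \<subseteq> B \<and> card U = q then u (L \<union> U) else 0)"
  have IntB: "(L \<union> U) \<inter> B = U" if "L \<subseteq> A" "U \<subseteq> B" for L U using that disjoint by blast
  have uu_in: "uu L \<in> set_chains B q" for L
    unfolding set_chains_def uu_def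
    using set_chainsD(2)[OF u] order_chain_subset by (fastforce split: if_splits)
  have uu_cycle: "set_boundary B (uu L) = 0" if L: "L \<subseteq> A" for L
  proof
    fix U
    show "set_boundary B (uu L) U = 0 U"
    proof (cases "U \<subseteq> B \<and> Suc (card U) = q")
      case True
      then have U: "U \<subseteq> B" "finite U" using fin_B finite_subset by auto
      have "0 = set_boundary (A \<union> B) u (L \<union> U)" using cyc by simp
      also have "\<dots> = (-1) ^ card L * (\<Sum>y\<in>B - U. removal_sign y U * u (L \<union> insert y U))"
      proof -
        have "u (insert y L \<union> U) = 0" if "y \<in> A - L" for y
          using that L U True by (intro van, subst IntB) auto
        then show ?thesis unfolding set_boundary_split[OF L U(1)] by simp
      qed
      also have "(\<Sum>y\<in>B - U. removal_sign y U * u (L \<union> insert y U)) = set_boundary B (uu L) U"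
        unfolding set_boundary_def uu_def
        by (rule sum.cong) (use True U in auto)
      finally show ?thesis by simp
    next
      case False
      have "uu L (insert y U) = 0" if "y \<in> B - U" for y
      proof (cases "U \<subseteq> B")
        case True
        then have "finite U" using fin_B finite_subset by auto
        then show ?thesis using that False True by (simp add: uu_def)
      qed (simp add: uu_def)
      then show ?thesis by (simp add: set_boundary_def)
    qed
  qed
  \<comment> \<open>A zero slice is given the zero filling. A nonzero filling at \<open>L\<close>
    then guarantees that \<open>L\<close> is a chain of size \<open>k - q\<close>.\<close>
  have "\<exists>v. v \<in> set_chains B (Suc q) \<and> set_boundary B v = uu L \<and> (uu L = 0 \<longrightarrow> v = 0)"
    if L: "L \<subseteq> A" for L
  proof (cases "uu L = 0")
    case True
    then show ?thesis by (intro exI[of _ 0]) auto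
  next
    case False
    then show ?thesis
      using B q uu_in[of L] uu_cycle[OF L] unfolding acyclic_below_def by blast
  qed
  then obtain vv where vv: "\<And>L. L \<subseteq> A \<Longrightarrow> vv L \<in> set_chains B (Suc q)"
    "\<And>L. L \<subseteq> A \<Longrightarrow> set_boundary B (vv L) = uu L"
    "\<And>L. L \<subseteq> A \<Longrightarrow> uu L = 0 \<Longrightarrow> vv L = 0"
    by metis
  \<comment> \<open>The sign cancels the factor that \<open>set_boundary_split\<close> puts before
    the boundary in \<open>B\<close>.\<close>
  define v where "v = (\<lambda>S. if S \<subseteq> A \<union> B then (-1) ^ card (S \<inter> A) * vv (S \<inter> A) (S \<inter> B) else 0)"
  have v_split: "v (L \<union> U) = (-1) ^ card L * vv L U" if "L \<subseteq> A" "U \<subseteq> B" for L U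
  proof -
    have "(L \<union> U) \<inter> A = L" using that disjoint by blast
    then show ?thesis using that by (auto simp: v_def IntB)
  qed
  have v_in: "v \<in> set_chains (A \<union> B) (Suc k)"
    unfolding set_chains_def
  proof (intro CollectI allI impI)
    fix S assume nz: "v S \<noteq> 0"
    define L U where "L = S \<inter> A" and "U = S \<inter> B"
    have S: "S \<subseteq> A \<union> B" using nz by (auto simp: v_def split: if_splits)
    have LU: "L \<subseteq> A" "U \<subseteq> B" "S = L \<union> U" using S by (auto simp: L_def U_def)
    have nz': "vv L U \<noteq> 0" using nz v_split[OF LU(1,2)] LU(3) by auto
    note D = set_chainsD[OF vv(1)[OF LU(1)] nz']
    from nz' vv(3)[OF LU(1)] have "uu L \<noteq> 0" by auto
    then obtain U' where "uu L U' \<noteq> 0" by (auto simp: fun_eq_iff)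
    then have U': "U' \<subseteq> B" "card U' = q" "u (L \<union> U') \<noteq> 0" by (auto simp: uu_def split: if_splits)
    note E = set_chainsD[OF u U'(3)]
    have "order_chain L" using E(2) order_chain_subset by blast
    then show "S \<subseteq> A \<union> B \<and> order_chain S \<and> card S = Suc k"
      using S D E(3) order_chain_split[OF LU(1,2)] card_split[OF LU(1,2)] card_split[OF LU(1) U'(1)] U'(2) LU(3)
      by auto
  qed
  have "set_boundary (A \<union> B) v S = u S" if S: "card (S \<inter> B) \<le> q" for S
  proof (cases "S \<subseteq> A \<union> B")
    case False
    then show ?thesis
      using set_boundary_not_subset[OF v_in] set_chainsD(1)[OF u] by metis
  next
    case True
    define L U where "L = S \<inter> A" and "U = S \<inter> B"
    have LU: "L \<subseteq> A" "U \<subseteq> B" "S = L \<union> U" using True by (auto simp: L_def U_def)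
    have finU: "finite U" using LU(2) fin_B finite_subset by auto
    have cU: "card U \<le> q" using S by (simp add: U_def)
    have z: "v (insert y L \<union> U) = 0" if "y \<in> A - L" for y
    proof -
      have iL: "insert y L \<subseteq> A" using that LU by auto
      have "vv (insert y L) U = 0"
        using set_chainsD(3)[OF vv(1)[OF iL], of U] cU by fastforce
      then show ?thesis using v_split[OF iL LU(2)] by simp
    qed
    have "set_boundary (A \<union> B) v S =
        (-1) ^ card L * (\<Sum>y\<in>B - U. removal_sign y U * v (L \<union> insert y U))"
      unfolding LU(3) set_boundary_split[OF LU(1,2)] using z by simp
    also have "(\<Sum>y\<in>B - U. removal_sign y U * v (L \<union> insert y U)) =
        (-1) ^ card L * set_boundary B (vv L) U"
      unfolding set_boundary_def sum_distrib_left
      by (rule sum.cong) (use LU in \<open>auto simp: v_split simp del: Un_insert_right\<close>)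
    also have "set_boundary B (vv L) U = uu L U" using vv(2)[OF LU(1)] by simp
    also have "uu L U = u S"
      using van[of S] LU cU S IntB[OF LU(1,2)] by (auto simp: uu_def)
    finally show ?thesis by (simp flip: mult.assoc power_mult_distrib)
  qed
  with v_in show ?thesis by blast
qed

text \<open>Subtracting the boundary found so far leaves a cycle that vanishes in the layers already
  treated.\<close>

lemma eliminate_upper_degrees:
  assumes u: "u \<in> set_chains (A \<union> B) k" and cyc: "set_boundary (A \<union> B) u = 0"
    and B: "acyclic_below B b"
  shows "q \<le> b \<Longrightarrow> \<exists>v\<in>set_chains (A \<union> B) (Suc k).
    \<forall>S. card (S \<inter> B) < q \<longrightarrow> set_boundary (A \<union> B) v S = u S"
proof (induction q)
  case 0
  show ?case by (rule bexI[of _ 0]) auto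
next
  case (Suc q)
  then obtain v where v: "v \<in> set_chains (A \<union> B) (Suc k)"
    "\<And>S. card (S \<inter> B) < q \<Longrightarrow> set_boundary (A \<union> B) v S = u S" by auto
  have fin: "finite (A \<union> B)" using fin_A fin_B by simp
  let ?u = "u - set_boundary (A \<union> B) v"
  have "?u \<in> set_chains (A \<union> B) k"
    using u set_boundary_in[OF v(1) fin] by (rule set_chains_diff)
  moreover have "set_boundary (A \<union> B) ?u = 0"
    using cyc set_boundary_boundary[OF v(1) fin] by (simp add: set_boundary_diff)
  ultimately obtain v' where v': "v' \<in> set_chains (A \<union> B) (Suc k)"
    "\<And>S. card (S \<inter> B) \<le> q \<Longrightarrow> set_boundary (A \<union> B) v' S = ?u S"
    using eliminate_upper_degree[of ?u k q b] v(2) B Suc.prems by auto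
  show ?case
  proof (intro bexI[of _ "v + v'"] allI impI)
    show "v + v' \<in> set_chains (A \<union> B) (Suc k)" using v(1) v'(1) by (rule set_chains_add)
    show "set_boundary (A \<union> B) (v + v') S = u S" if "card (S \<inter> B) < Suc q" for S
      using v'(2)[of S] that by (simp add: set_boundary_add)
  qed
qed

end

section \<open>Rank-nullity and linear sections over the rationals\<close>

lemma sum_fun_apply: "(\<Sum>i\<in>I. f i) x = (\<Sum>i\<in>I. f i x)" for f :: "'i \<Rightarrow> 'x \<Rightarrow> 'b::comm_monoid_add"
  by (induction I rule: infinite_finite_induct) auto

text \<open>The ambient function space may be infinite dimensional, hence the subspace inside a
  finite span. A basis of the kernel is extended to one of \<open>V\<close>, and the added vectors
  map to a basis of the image.\<close>

lemma (in vector_space_pair) dim_kernel_image: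
  assumes f: "Vector_Spaces.linear s1 s2 f" and V: "vs1.subspace V" and fin: "V \<subseteq> vs1.span G" "finite G"
  shows "vs1.dim V = vs1.dim {v \<in> V. f v = 0} + vs2.dim (f ` V)"
proof -
  interpret f: Vector_Spaces.linear s1 s2 f by fact
  let ?K = "{v \<in> V. f v = 0}"
  obtain BK where BK: "BK \<subseteq> ?K" "vs1.independent BK" "?K \<subseteq> vs1.span BK" "card BK = vs1.dim ?K"
    using vs1.basis_exists by blast
  obtain B where B: "BK \<subseteq> B" "B \<subseteq> V" "vs1.independent B" "V \<subseteq> vs1.span B"
    using vs1.maximal_independent_subset_extend[of BK V] BK(1,2) by blast
  have finB: "finite B"
    using vs1.independent_span_bound[OF fin(2) B(3)] B(2) fin(1) by blast
  let ?C = "B - BK"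
  have indC: "vs1.independent ?C" using B(3) vs1.independent_mono by blast
  have span_eq: "vs1.span B = V"
    using vs1.span_subspace[OF B(2,4) V] .
  have inj: "inj_on f (vs1.span ?C)"
    unfolding f.inj_on_iff_eq_0[OF vs1.subspace_span]
  proof (intro ballI impI)
    fix v assume v: "v \<in> vs1.span ?C" "f v = 0"
    have "v \<in> V" using v(1) vs1.span_mono[of ?C B] span_eq by blast
    with v BK(3) have vK: "v \<in> vs1.span BK" by blast
    \<comment> \<open>\<open>v\<close> is a combination of kernel basis vectors and also of the
      added ones. These are disjoint parts of one basis, so all coordinates vanish.\<close>
    have eq1: "vs1.representation B v = vs1.representation BK v"
      by (rule vs1.representation_extend[OF B(3) vK B(1)])
    have eq2: "vs1.representation B v = vs1.representation ?C v"
      by (rule vs1.representation_extend[OF B(3) v(1)]) auto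
    have "vs1.representation BK v b = 0" for b
      using vs1.representation_ne_zero[of BK v b] vs1.representation_ne_zero[of ?C v b] eq1 eq2 by auto
    then show "v = 0"
      using vs1.sum_nonzero_representation_eq[OF BK(2) vK] by simp
  qed
  have indfC: "vs2.independent (f ` ?C)"
    by (rule f.independent_injective_image[OF indC inj])
  have "f ` V \<subseteq> vs2.span (f ` ?C)"
  proof -
    have "f ` B \<subseteq> insert 0 (f ` ?C)" using BK(1) by auto
    then have "vs2.span (f ` B) \<subseteq> vs2.span (insert 0 (f ` ?C))" by (rule vs2.span_mono)
    then show ?thesis by (simp add: f.span_image span_eq)
  qed
  then have "card (f ` ?C) = vs2.dim (f ` V)"
    using indfC B(2) by (intro vs2.basis_card_eq_dim) auto
  moreover have "card (f ` ?C) = card ?C"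
    using inj_on_subset[OF inj vs1.span_superset] by (rule card_image)
  moreover have "card B = vs1.dim V"
    using B by (intro vs1.basis_card_eq_dim) auto
  moreover have "card B = card BK + card ?C"
    using finB B(1) by (metis card_Diff_subset card_mono finite_subset le_add_diff_inverse)
  ultimately show ?thesis using BK(4) by simp
qed

interpretation rat_fun: vector_space "\<lambda>(c::rat) (f :: 'x \<Rightarrow> rat) x. c * f x"
  by unfold_locales (auto simp: fun_eq_iff algebra_simps)

interpretation rat_fun_pair: vector_space_pair "\<lambda>(c::rat) (f :: 'x \<Rightarrow> rat) x. c * f x"
    "\<lambda>(c::rat) (f :: 'y \<Rightarrow> rat) x. c * f x"
  by unfold_locales

lemma linear_set_boundary:
  "Vector_Spaces.linear (\<lambda>(c::rat) f x. c * f x) (\<lambda>(c::rat) f x. c * f x) (set_boundary X)"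
  unfolding Vector_Spaces.linear_iff
  by (auto simp: rat_fun.vector_space_axioms set_boundary_add fun_eq_iff set_boundary_def
      sum_distrib_left ac_simps)

lemma subspace_set_chains: "rat_fun.subspace (set_chains X k)"
  unfolding rat_fun.subspace_def
  by (auto simp: set_chains_add) (auto simp: set_chains_def)

text \<open>Over a field the boundary map has a linear right inverse on its image. It sends every
  function, boundary or not, to a chain, so the support of its values is known.\<close>

lemma set_boundary_section:
  obtains h where "\<And>f. h f \<in> set_chains X (Suc k)"
    "Vector_Spaces.linear (\<lambda>(c::rat) f x. c * f x) (\<lambda>(c::rat) f x. c * f x) h"
    "\<And>w. w \<in> set_chains X (Suc k) \<Longrightarrow> set_boundary X (h (set_boundary X w)) = set_boundary X w"
  using rat_fun_pair.linear_exists_right_inverse_on[OF linear_set_boundary subspace_set_chains[of X "Suc k"], of X]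
  by blast

context poset_join
begin

text \<open>Fillings in the direction of \<open>A\<close> are chosen by a linear section of the boundary map, so that
  they commute with the boundary in the direction of \<open>B\<close>.\<close>

lemma eliminate_top_degree:
  assumes u: "u \<in> set_chains (A \<union> B) k" and cyc: "set_boundary (A \<union> B) u = 0"
    and conc: "\<And>S. u S \<noteq> 0 \<Longrightarrow> card (S \<inter> B) = b"
    and A: "acyclic_below A a" and k: "k < a + b"
  shows "\<exists>v\<in>set_chains (A \<union> B) (Suc k). set_boundary (A \<union> B) v = u"
proof (cases "k < b")
  case True
  \<comment> \<open>A set of \<open>k < b\<close> elements cannot meet \<open>B\<close> in
    \<open>b\<close> elements.\<close>
  have "u = 0"
  proof
    fix S
    show "u S = 0 S"
    proof (rule ccontr)
      assume "u S \<noteq> 0 S"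
      then have nz: "u S \<noteq> 0" by simp
      note D = set_chainsD[OF u nz]
      have "finite S" using D(1) fin_A fin_B by (auto intro: finite_subset)
      then have "card (S \<inter> B) \<le> k" using D(3) by (metis Int_lower1 card_mono)
      then show False using conc[OF nz] True by simp
    qed
  qed
  then show ?thesis by (intro bexI[of _ 0]) auto
next
  case False
  define m where "m = k - b"
  have m: "k = m + b" "m < a" using False k by (auto simp: m_def)
  obtain h where h: "\<And>f. h f \<in> set_chains A (Suc m)"
    "Vector_Spaces.linear (\<lambda>(c::rat) f x. c * f x) (\<lambda>(c::rat) f x. c * f x) h"
    "\<And>w. w \<in> set_chains A (Suc m) \<Longrightarrow> set_boundary A (h (set_boundary A w)) = set_boundary A w"
    using set_boundary_section[of A m] by metis
  interpret h: Vector_Spaces.linear "\<lambda>(c::rat) f x. c * f x" "\<lambda>(c::rat) f x. c * f x" h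
    by (rule h(2))
  define uu where "uu = (\<lambda>U L. if L \<subseteq> A then u (L \<union> U) else 0)"
  have IntB: "(L \<union> U) \<inter> B = U" if "L \<subseteq> A" "U \<subseteq> B" for L U using that disjoint by blast
  have nz: "card U = b" "order_chain U" if "uu U L \<noteq> 0" "U \<subseteq> B" for U L
  proof -
    have L: "L \<subseteq> A" "u (L \<union> U) \<noteq> 0" using that(1) by (auto simp: uu_def split: if_splits)
    show "card U = b" using conc[OF L(2)] IntB[OF L(1) that(2)] by simp
    show "order_chain U" using set_chainsD(2)[OF u L(2)] order_chain_subset by blast
  qed
  have uu_in: "uu U \<in> set_chains A m" if U: "U \<subseteq> B" for U
    unfolding set_chains_def
  proof (intro CollectI allI impI)
    fix L assume n: "uu U L \<noteq> 0"
    have L: "L \<subseteq> A" "u (L \<union> U) \<noteq> 0" using n by (auto simp: uu_def split: if_splits)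
    note D = set_chainsD[OF u L(2)]
    show "L \<subseteq> A \<and> order_chain L \<and> card L = m"
      using L(1) D(3) order_chain_subset[OF D(2)] nz(1)[OF n U] card_split[OF L(1) U] m by auto
  qed
  have uu_section: "set_boundary A (h (uu U)) = uu U" if U: "U \<subseteq> B" for U
  proof -
    have "set_boundary A (uu U) = 0"
    proof
      fix L
      show "set_boundary A (uu U) L = 0 L"
      proof (cases "L \<subseteq> A \<and> card U = b")
        case True
        \<comment> \<open>One more element of \<open>B\<close> would make \<open>b + 1\<close>,
          where \<open>u\<close> vanishes. The cycle equation thus only sees the direction of
          \<open>A\<close>.\<close>
        have "u (L \<union> insert y U) = 0" if "y \<in> B - U" for y
        proof (rule ccontr)
          assume "u (L \<union> insert y U) \<noteq> 0"
          from conc[OF this] show False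
            using IntB[of L "insert y U"] True that U fin_B finite_subset[OF U] by auto
        qed
        then have "set_boundary (A \<union> B) u (L \<union> U) = (\<Sum>y\<in>A - L. removal_sign y L * u (insert y L \<union> U))"
          using True U by (simp add: set_boundary_split)
        then show ?thesis using True cyc
          by (auto simp: set_boundary_def uu_def intro!: sum.cong)
      next
        case False
        have "uu U (insert y L) = 0" for y
        proof (rule ccontr)
          assume n: "uu U (insert y L) \<noteq> 0"
          then have "insert y L \<subseteq> A" by (auto simp: uu_def split: if_splits)
          with nz(1)[OF n U] False show False by simp
        qed
        then show ?thesis by (simp add: set_boundary_def)
      qed
    qed
    then obtain w where "w \<in> set_chains A (Suc m)" "set_boundary A w = uu U"
      using A m(2) uu_in[OF U] unfolding acyclic_below_def by blast
    then show ?thesis using h(3) by metis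
  qed
  define v where "v = (\<lambda>S. if S \<subseteq> A \<union> B then h (uu (S \<inter> B)) (S \<inter> A) else 0)"
  have v_split: "v (L \<union> U) = h (uu U) L" if "L \<subseteq> A" "U \<subseteq> B" for L U
  proof -
    have "(L \<union> U) \<inter> A = L" using that disjoint by blast
    then show ?thesis using that by (auto simp: v_def IntB)
  qed
  have v_in: "v \<in> set_chains (A \<union> B) (Suc k)"
    unfolding set_chains_def
  proof (intro CollectI allI impI)
    fix S assume n: "v S \<noteq> 0"
    define L U where "L = S \<inter> A" and "U = S \<inter> B"
    have S: "S \<subseteq> A \<union> B" using n by (auto simp: v_def split: if_splits)
    have LU: "L \<subseteq> A" "U \<subseteq> B" "S = L \<union> U" using S by (auto simp: L_def U_def)
    have n': "h (uu U) L \<noteq> 0" using n v_split[OF LU(1,2)] LU(3) by auto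
    have "uu U \<noteq> 0"
    proof
      assume "uu U = 0"
      then have "h (uu U) = 0" using h.zero by simp
      with n' show False by simp
    qed
    then obtain L' where "uu U L' \<noteq> 0" by (auto simp: fun_eq_iff)
    note U = nz[OF this LU(2)]
    note D = set_chainsD[OF h(1) n']
    show "S \<subseteq> A \<union> B \<and> order_chain S \<and> card S = Suc k"
      using S D U order_chain_split[OF LU(1,2)] card_split[OF LU(1,2)] LU(3) m by auto
  qed
  have "set_boundary (A \<union> B) v S = u S" for S
  proof (cases "S \<subseteq> A \<union> B")
    case False
    then show ?thesis
      using set_boundary_not_subset[OF v_in] set_chainsD(1)[OF u] by metis
  next
    case True
    define L U where "L = S \<inter> A" and "U = S \<inter> B"
    have LU: "L \<subseteq> A" "U \<subseteq> B" "S = L \<union> U" using True by (auto simp: L_def U_def)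
    have finU: "finite U" using LU(2) fin_B finite_subset by auto
    let ?g = "\<lambda>y. (\<lambda>L. removal_sign y U * uu (insert y U) L)"
    \<comment> \<open>For \<open>card U = b - 1\<close> the cycle equation says that the signed
      slices sum to zero. Linearity of \<open>h\<close> transfers this to the fillings, so the
      boundary of \<open>v\<close> in the direction of \<open>B\<close> vanishes.\<close>
    have zero: "(\<Sum>y\<in>B - U. ?g y) = 0"
    proof
      fix L'
      show "(\<Sum>y\<in>B - U. ?g y) L' = 0 L'"
      proof (cases "L' \<subseteq> A \<and> Suc (card U) = b")
        case True
        have "u (insert y L' \<union> U) = 0" if "y \<in> A - L'" for y
        proof (rule ccontr)
          assume "u (insert y L' \<union> U) \<noteq> 0"
          from conc[OF this] show False
            using IntB[of "insert y L'" U] True that LU by auto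
        qed
        then have "set_boundary (A \<union> B) u (L' \<union> U) =
            (-1) ^ card L' * (\<Sum>y\<in>B - U. removal_sign y U * u (L' \<union> insert y U))"
          using True LU(2) by (simp add: set_boundary_split)
        then show ?thesis using cyc True by (simp add: uu_def sum_fun_apply)
      next
        case False
        have "uu (insert y U) L' = 0" if y: "y \<in> B - U" for y
        proof (rule ccontr)
          assume n: "uu (insert y U) L' \<noteq> 0"
          then have "L' \<subseteq> A" by (auto simp: uu_def split: if_splits)
          moreover have "card (insert y U) = b" using nz(1)[OF n] y LU(2) by simp
          ultimately show False using False finU y by simp
        qed
        then show ?thesis by (simp add: sum_fun_apply)
      qed
    qed
    have "set_boundary (A \<union> B) v S = (\<Sum>y\<in>A - L. removal_sign y L * v (insert y L \<union> U)) +
        (-1) ^ card L * (\<Sum>y\<in>B - U. removal_sign y U * v (L \<union> insert y U))"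
      unfolding LU(3) set_boundary_split[OF LU(1,2)] by simp
    also have "(\<Sum>y\<in>A - L. removal_sign y L * v (insert y L \<union> U)) = set_boundary A (h (uu U)) L"
      unfolding set_boundary_def
      by (rule sum.cong) (use LU v_split in \<open>auto simp del: Un_insert_left\<close>)
    also have "(\<Sum>y\<in>B - U. removal_sign y U * v (L \<union> insert y U)) =
        (\<Sum>y\<in>B - U. h (?g y)) L"
      unfolding sum_fun_apply h.scale
      by (rule sum.cong) (use LU v_split in \<open>auto simp del: Un_insert_right\<close>)
    also have "(\<Sum>y\<in>B - U. h (?g y)) = h (\<Sum>y\<in>B - U. ?g y)" by (simp add: h.sum)
    also have "\<dots> = 0" unfolding zero by (rule h.zero)
    also have "set_boundary A (h (uu U)) L = u S"
      using uu_section[OF LU(2)] LU by (simp add: uu_def)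
    finally show ?thesis by simp
  qed
  then show ?thesis using v_in by blast
qed

text \<open>The vanishing part of the Kuenneth formula. Acyclicity of \<open>B\<close> moves a cycle
  into chains with at least \<open>b\<close> elements in \<open>B\<close>, and \<open>bound\<close>
  makes this exactly \<open>b\<close>. As \<open>k < a + b\<close>, fewer than \<open>a\<close>
  elements lie in \<open>A\<close>, and acyclicity of \<open>A\<close> applies.\<close>

lemma acyclic_below_join:
  assumes A: "acyclic_below A a" and B: "acyclic_below B b"
    and bound: "\<And>U. U \<subseteq> B \<Longrightarrow> order_chain U \<Longrightarrow> card U \<le> b"
  shows "acyclic_below (A \<union> B) (a + b)"
  unfolding acyclic_below_def
proof (intro allI impI ballI)
  fix k z assume k: "k < a + b" and z: "z \<in> set_chains (A \<union> B) k" "set_boundary (A \<union> B) z = 0"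
  have fin: "finite (A \<union> B)" using fin_A fin_B by simp
  obtain v where v: "v \<in> set_chains (A \<union> B) (Suc k)"
    "\<And>S. card (S \<inter> B) < b \<Longrightarrow> set_boundary (A \<union> B) v S = z S"
    using eliminate_upper_degrees[OF z B order.refl] by blast
  let ?u = "z - set_boundary (A \<union> B) v"
  have u: "?u \<in> set_chains (A \<union> B) k"
    using z(1) set_boundary_in[OF v(1) fin] by (rule set_chains_diff)
  moreover have "set_boundary (A \<union> B) ?u = 0"
    using z(2) set_boundary_boundary[OF v(1) fin] by (simp add: set_boundary_diff)
  moreover have "card (S \<inter> B) = b" if "?u S \<noteq> 0" for S
  proof -
    have "\<not> card (S \<inter> B) < b" using v(2) that by fastforce
    moreover have "card (S \<inter> B) \<le> b"
      using bound[of "S \<inter> B"] set_chainsD(2)[OF u that] order_chain_subset by blast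
    ultimately show ?thesis by simp
  qed
  ultimately obtain w where w: "w \<in> set_chains (A \<union> B) (Suc k)" "set_boundary (A \<union> B) w = ?u"
    using eliminate_top_degree[OF _ _ _ A k] by blast
  show "\<exists>w\<in>set_chains (A \<union> B) (Suc k). set_boundary (A \<union> B) w = z"
  proof (intro bexI)
    show "set_boundary (A \<union> B) (v + w) = z" using w(2) by (simp add: set_boundary_add)
  qed (rule set_chains_add[OF v(1) w(1)])
qed

end

section \<open>Deletion of an antichain\<close>

lemma removal_sign_swap:
  assumes "finite S" "x \<notin> S" "y \<notin> S" "x < y \<or> y < x"
  shows "removal_sign y (insert x S) * removal_sign x (insert y S) = - (removal_sign y S * removal_sign x S)"
  using assms by (auto simp: removal_sign_insert)

text \<open>A filling of a cycle of \<open>X\<close> in \<open>X \<union> I\<close> restricts to a cycle in the link of each \<open>x \<in> I\<close>;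
  filling these cycles removes \<open>I\<close> from the support.\<close>

lemma acyclic_below_remove_antichain:
  assumes fin: "finite X" "finite I" and disj: "X \<inter> I = {}"
    and anti: "\<And>x y. x \<in> I \<Longrightarrow> y \<in> I \<Longrightarrow> x \<le> y \<Longrightarrow> x = y"
    and whole: "acyclic_below (X \<union> I) (Suc n)"
    and links: "\<And>x. x \<in> I \<Longrightarrow> acyclic_below {y \<in> X. y < x \<or> x < y} n"
  shows "acyclic_below X n"
  unfolding acyclic_below_def
proof (intro allI impI ballI)
  fix k z assume k: "k < n" and z: "z \<in> set_chains X k" "set_boundary X z = 0"
  have finU: "finite (X \<union> I)" using fin by simp
  have "set_boundary (X \<union> I) z = 0"
    using set_boundary_mono[OF z(1) _ finU] z(2) by simp
  then obtain w where w: "w \<in> set_chains (X \<union> I) (Suc k)" "set_boundary (X \<union> I) w = z"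
    using whole k z(1) set_chains_mono[of X "X \<union> I" k]
    unfolding acyclic_below_def by (meson Un_upper1 less_SucI subsetD)
  define lk where "lk = (\<lambda>x. {y \<in> X. y < x \<or> x < y})"
  \<comment> \<open>The part of \<open>w\<close> on chains through \<open>x\<close>, with
    \<open>x\<close> deleted; the sign makes it a chain on the link.\<close>
  define wx where "wx = (\<lambda>x S. if S \<subseteq> X then removal_sign x S * w (insert x S) else 0)"
  have two: "\<not> order_chain S" if "x \<in> I" "y \<in> I" "x \<noteq> y" "x \<in> S" "y \<in> S" for x y S
    using anti that by (auto simp: Complete_Partial_Order.chain_def)
  have link: "S \<subseteq> lk x" if "order_chain (insert x S)" "S \<subseteq> X" "x \<in> I" for x S
  proof
    fix y assume y: "y \<in> S"
    then have "y \<noteq> x" "y \<le> x \<or> x \<le> y"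
      using that disj by (auto simp: Complete_Partial_Order.chain_def)
    then show "y \<in> lk x" using y that(2) by (auto simp: lk_def)
  qed
  have wx_in: "wx x \<in> set_chains (lk x) k" if x: "x \<in> I" for x
    unfolding set_chains_def
  proof (intro CollectI allI impI)
    fix S assume "wx x S \<noteq> 0"
    then have S: "S \<subseteq> X" "w (insert x S) \<noteq> 0" by (auto simp: wx_def split: if_splits)
    note D = set_chainsD[OF w(1) S(2)]
    have "x \<notin> S" using S(1) x disj by auto
    then have "card S = k" using D(3) finite_subset[OF S(1) fin(1)] by simp
    then show "S \<subseteq> lk x \<and> order_chain S \<and> card S = k"
      using link[OF D(2) S(1) x] order_chain_subset[OF D(2)] by auto
  qed
  \<comment> \<open>Interchanging \<open>x\<close> and \<open>y\<close> costs one sign, so the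
    boundary terms that keep \<open>x\<close> amount to minus the boundary in the link.\<close>
  have comb: "(\<Sum>y\<in>X - S. removal_sign y (insert x S) * (removal_sign x (insert y S) * g (insert y S))) =
      - removal_sign x S * set_boundary (lk x) g S"
    if x: "x \<in> I" and S: "S \<subseteq> X" and g: "g \<in> set_chains (lk x) m" for x S g m
  proof -
    have "removal_sign y (insert x S) * (removal_sign x (insert y S) * g (insert y S)) =
        - removal_sign x S * (removal_sign y S * g (insert y S))" if y: "y \<in> X - S" for y
    proof (cases "g (insert y S) = 0")
      case False
      then have "y \<in> lk x" using set_chainsD(1)[OF g] by auto
      then have "x < y \<or> y < x" by (auto simp: lk_def)
      moreover have "x \<notin> S" "y \<notin> S" using S x disj y by auto
      ultimately show ?thesis
        using removal_sign_swap[OF finite_subset[OF S fin(1)]] by (simp flip: mult.assoc)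
    qed simp
    then have "(\<Sum>y\<in>X - S. removal_sign y (insert x S) * (removal_sign x (insert y S) * g (insert y S))) =
        - removal_sign x S * set_boundary X g S"
      by (simp add: set_boundary_def sum_distrib_left sum_negf)
    also have "set_boundary X g = set_boundary (lk x) g"
      by (rule set_boundary_mono[OF g _ fin(1)]) (auto simp: lk_def)
    finally show ?thesis .
  qed
  have split: "set_boundary (X \<union> I) f (insert x S) =
      (\<Sum>y\<in>X - S. removal_sign y (insert x S) * f (insert x (insert y S)))"
    if x: "x \<in> I" and S: "S \<subseteq> X" and f: "f \<in> set_chains (X \<union> I) m" for x S f m
    unfolding set_boundary_def
  proof (rule sum.mono_neutral_cong_right)
    show "\<forall>y\<in>(X \<union> I - insert x S) - (X - S). removal_sign y (insert x S) * f (insert y (insert x S)) = 0"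
    proof
      fix y assume "y \<in> (X \<union> I - insert x S) - (X - S)"
      then have "y \<in> I" "y \<noteq> x" by auto
      then have "\<not> order_chain (insert y (insert x S))" using two[of y x] x by blast
      then show "removal_sign y (insert x S) * f (insert y (insert x S)) = 0"
        using set_chainsD(2)[OF f] by force
    qed
  qed (use finU x disj in \<open>auto simp: insert_commute\<close>)
  have wx_cycle: "set_boundary (lk x) (wx x) = 0" if x: "x \<in> I" for x
  proof
    fix S
    show "set_boundary (lk x) (wx x) S = 0 S"
    proof (cases "S \<subseteq> X")
      case False
      then show ?thesis
        using set_boundary_not_subset[OF wx_in[OF x], of S] by (auto simp: lk_def)
    next
      case True
      \<comment> \<open>The chain \<open>z\<close> avoids \<open>x\<close>, so the boundary of
        \<open>w\<close> has no coefficient on chains through \<open>x\<close>.\<close>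
      have "z (insert x S) = 0" using set_chainsD(1)[OF z(1), of "insert x S"] x disj by auto
      then have "0 = (\<Sum>y\<in>X - S. removal_sign y (insert x S) * w (insert x (insert y S)))"
        using w(2) split[OF x True w(1)] by simp
      also have "\<dots> = (\<Sum>y\<in>X - S. removal_sign y (insert x S) * (removal_sign x (insert y S) * wx x (insert y S)))"
        by (rule sum.cong) (use True in \<open>auto simp: wx_def simp flip: mult.assoc\<close>)
      also have "\<dots> = - removal_sign x S * set_boundary (lk x) (wx x) S"
        by (rule comb[OF x True wx_in[OF x]])
      finally show ?thesis by simp
    qed
  qed
  have "\<forall>x\<in>I. \<exists>v\<in>set_chains (lk x) (Suc k). set_boundary (lk x) v = wx x"
    using links k wx_in wx_cycle unfolding acyclic_below_def lk_def by blast
  then obtain vx where vx: "\<And>x. x \<in> I \<Longrightarrow> vx x \<in> set_chains (lk x) (Suc k)"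
    "\<And>x. x \<in> I \<Longrightarrow> set_boundary (lk x) (vx x) = wx x"
    by metis
  \<comment> \<open>Cones with apex \<open>x\<close> over the fillings \<open>vx x\<close>. Distinct
    elements of \<open>I\<close> are incomparable, so at a chain the sum has at most one
    term.\<close>
  define v where "v = (\<lambda>S. \<Sum>x\<in>I \<inter> S. removal_sign x (S - {x}) * vx x (S - {x}))"
  have v_in: "v \<in> set_chains (X \<union> I) (Suc (Suc k))"
    unfolding set_chains_def
  proof (intro CollectI allI impI)
    fix S assume "v S \<noteq> 0"
    then obtain x where x: "x \<in> I \<inter> S" "vx x (S - {x}) \<noteq> 0"
      unfolding v_def by (metis (no_types, lifting) mult_zero_right sum.neutral)
    have xI: "x \<in> I" using x(1) by simp
    note D = set_chainsD[OF vx(1)[OF xI] x(2)]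
    have S: "S = insert x (S - {x})" using x(1) by auto
    have "order_chain (insert x (S - {x}))"
      by (rule order_chain_insert[OF D(2)]) (use D(1) in \<open>auto simp: lk_def less_imp_le\<close>)
    moreover have "finite (S - {x})" using finite_subset[OF D(1)] fin(1) by (simp add: lk_def)
    then have "card (insert x (S - {x})) = Suc (Suc k)" using D(3) by (subst card_insert_disjoint) auto
    moreover have "S \<subseteq> X \<union> I" using D(1) xI by (auto simp: lk_def)
    ultimately show "S \<subseteq> X \<union> I \<and> order_chain S \<and> card S = Suc (Suc k)" using S by simp
  qed
  have v_eq: "v (insert x S) = removal_sign x S * vx x S" if "x \<in> I" "S \<subseteq> X" for x S
  proof -
    have "I \<inter> insert x S = {x}" "insert x S - {x} = S" using that disj by auto
    then show ?thesis by (simp add: v_def)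
  qed
  \<comment> \<open>Adding a boundary keeps \<open>z\<close> as the boundary, and the cones cancel
    all coefficients on chains through \<open>I\<close>.\<close>
  let ?w = "w + set_boundary (X \<union> I) v"
  have w'_in: "?w \<in> set_chains (X \<union> I) (Suc k)"
    using w(1) set_boundary_in[OF v_in finU] by (rule set_chains_add)
  have w'_zero: "?w (insert x S) = 0" if x: "x \<in> I" and S: "S \<subseteq> X" for x S
  proof -
    have "set_boundary (X \<union> I) v (insert x S) =
        (\<Sum>y\<in>X - S. removal_sign y (insert x S) * (removal_sign x (insert y S) * vx x (insert y S)))"
      unfolding split[OF x S v_in] by (rule sum.cong) (use S x in \<open>auto simp: v_eq\<close>)
    also have "\<dots> = - removal_sign x S * wx x S"
      using comb[OF x S vx(1)[OF x]] vx(2)[OF x] by simp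
    also have "\<dots> = - w (insert x S)" using S by (simp add: wx_def flip: mult.assoc)
    finally show ?thesis by simp
  qed
  have w': "?w \<in> set_chains X (Suc k)"
    unfolding set_chains_def
  proof (intro CollectI allI impI)
    fix S assume nz: "?w S \<noteq> 0"
    note D = set_chainsD[OF w'_in nz]
    have "x \<notin> S" if x: "x \<in> I" for x
    proof
      assume xS: "x \<in> S"
      have "S - {x} \<subseteq> X" using two[OF x _ _ xS] D(1,2) by blast
      from w'_zero[OF x this] nz show False using xS by (simp add: insert_absorb)
    qed
    then show "S \<subseteq> X \<and> order_chain S \<and> card S = Suc k" using D by auto
  qed
  show "\<exists>w\<in>set_chains X (Suc k). set_boundary X w = z"
  proof (intro bexI)
    have "set_boundary X ?w = set_boundary (X \<union> I) ?w"
      by (rule set_boundary_mono[OF w' _ finU, symmetric]) simp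
    also have "\<dots> = z" using w(2) set_boundary_boundary[OF v_in finU] by (simp add: set_boundary_add)
    finally show "set_boundary X ?w = z" .
  qed (rule w')
qed

section \<open>Euler characteristics as dimensions\<close>

lemma dim_set_chains:
  assumes fin: "finite X"
  shows "rat_fun.dim (set_chains X k) = card {S. S \<subseteq> X \<and> order_chain S \<and> card S = k}"
    and "\<exists>G. finite G \<and> set_chains X k \<subseteq> rat_fun.span G"
proof -
  let ?I = "{S. S \<subseteq> X \<and> order_chain S \<and> card S = k}"
  let ?e = "\<lambda>S T. if T = S then 1 else 0 :: rat"
  let ?G = "?e ` ?I"
  have finI: "finite ?I" using fin by simp
  have inj: "inj_on ?e ?I"
  proof (rule inj_onI)
    fix S T assume "?e S = ?e T"
    from fun_cong[OF this, of S] show "S = T" by (simp split: if_splits)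
  qed
  have sub: "?G \<subseteq> set_chains X k" by (auto simp: set_chains_def split: if_splits)
  have eval: "(\<Sum>S\<in>?I. (\<lambda>T. c S * ?e S T)) T = (if T \<in> ?I then c T else 0)" for c :: "'a set \<Rightarrow> rat" and T
    unfolding sum_fun_apply using finI by (simp add: if_distrib[of "(*) _"] cong: if_cong)
  have span: "set_chains X k \<subseteq> rat_fun.span ?G"
  proof
    fix f assume f: "f \<in> set_chains X k"
    have "f = (\<Sum>S\<in>?I. (\<lambda>T. f S * ?e S T))"
    proof
      fix T
      show "f T = (\<Sum>S\<in>?I. (\<lambda>T. f S * ?e S T)) T"
        unfolding eval using f by (auto simp: set_chains_def)
    qed
    also have "\<dots> \<in> rat_fun.span ?G"
      by (intro rat_fun.span_sum rat_fun.span_scale rat_fun.span_base) auto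
    finally show "f \<in> rat_fun.span ?G" .
  qed
  have "rat_fun.independent ?G"
    unfolding rat_fun.dependent_finite[OF finite_imageI[OF finI]]
  proof
    assume "\<exists>c. (\<exists>v\<in>?G. c v \<noteq> 0) \<and> (\<Sum>v\<in>?G. (\<lambda>x. c v * v x)) = 0"
    then obtain c S where c: "(\<Sum>v\<in>?G. (\<lambda>x. c v * v x)) = 0" and S: "S \<in> ?I" "c (?e S) \<noteq> 0"
      by blast
    have "(\<Sum>v\<in>?G. (\<lambda>x. c v * v x)) = (\<Sum>T\<in>?I. (\<lambda>x. c (?e T) * ?e T x))"
      by (subst sum.reindex[OF inj]) simp
    then have "(if S \<in> ?I then c (?e S) else 0) = 0"
      using c eval[of "\<lambda>T. c (?e T)" S] by simp
    then show False using S by simp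
  qed
  then have "card ?G = rat_fun.dim (set_chains X k)"
    using sub span by (intro rat_fun.basis_card_eq_dim)
  then show "rat_fun.dim (set_chains X k) = card ?I" using card_image[OF inj] by simp
  show "\<exists>G. finite G \<and> set_chains X k \<subseteq> rat_fun.span G" using finI span by blast
qed

text \<open>By rank-nullity: up to size \<open>n\<close> the cycles of one size are the boundaries from the next.\<close>

lemma alternating_sum_chains_eq_dim:
  assumes fin: "finite X" and acyc: "acyclic_below X n" and "m \<le> n"
  shows "(\<Sum>k\<le>m. (-1) ^ (m - k) * int (card {S. S \<subseteq> X \<and> order_chain S \<and> card S = k})) =
    int (rat_fun.dim {f \<in> set_chains X m. set_boundary X f = 0})"
  using \<open>m \<le> n\<close>
proof (induction m)
  case 0
  \<comment> \<open>The augmented complex ends at size 0, so there every chain is a cycle.\<close>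
  have eq: "{f \<in> set_chains X 0. set_boundary X f = 0} = set_chains X 0"
    using set_boundary_degree_zero[OF _ fin] by blast
  show ?case unfolding eq dim_set_chains(1)[OF fin, of 0] by simp
next
  case (Suc m)
  let ?c = "\<lambda>k. int (card {S. S \<subseteq> X \<and> order_chain S \<and> card S = k})"
  obtain G where G: "finite G" "set_chains X (Suc m) \<subseteq> rat_fun.span G"
    using dim_set_chains(2)[OF fin] by blast
  have "set_boundary X ` set_chains X (Suc m) = {f \<in> set_chains X m. set_boundary X f = 0}"
  proof (intro equalityI subsetI)
    fix f assume "f \<in> set_boundary X ` set_chains X (Suc m)"
    then show "f \<in> {f \<in> set_chains X m. set_boundary X f = 0}"
      using set_boundary_in[OF _ fin] set_boundary_boundary[OF _ fin] by (elim imageE) (simp only: mem_Collect_eq)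
  next
    fix f assume "f \<in> {f \<in> set_chains X m. set_boundary X f = 0}"
    moreover have "m < n" using Suc.prems by simp
    ultimately obtain w where "w \<in> set_chains X (Suc m)" "set_boundary X w = f"
      using acyc unfolding acyclic_below_def by blast
    then show "f \<in> set_boundary X ` set_chains X (Suc m)" by blast
  qed
  then have rn: "?c (Suc m) = int (rat_fun.dim {f \<in> set_chains X (Suc m). set_boundary X f = 0}) +
      int (rat_fun.dim {f \<in> set_chains X m. set_boundary X f = 0})"
    using rat_fun_pair.dim_kernel_image[OF linear_set_boundary subspace_set_chains G(2,1), of X]
      dim_set_chains(1)[OF fin, of "Suc m"] by simp
  have step: "(\<Sum>k\<le>Suc m. (-1) ^ (Suc m - k) * ?c k) = ?c (Suc m) - (\<Sum>k\<le>m. (-1) ^ (m - k) * ?c k)"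
    by (simp add: Suc_diff_le sum_negf)
  show ?case unfolding step Suc.IH[OF Suc_leD[OF Suc.prems]] rn by linarith
qed

text \<open>With no chains of size above \<open>n\<close>, the alternating sum up to
  \<open>n\<close> is the whole Euler characteristic up to sign, and it is the dimension of the
  space of cycles of size \<open>n\<close>.\<close>

lemma signed_chain_count_nonneg:
  assumes fin: "finite X" and acyc: "acyclic_below X n"
    and bound: "\<And>S. S \<subseteq> X \<Longrightarrow> order_chain S \<Longrightarrow> card S \<le> n"
  shows "(-1) ^ n * (\<Sum>S | S \<subseteq> X \<and> order_chain S. (-1) ^ card S) \<ge> (0 :: int)"
proof -
  let ?I = "{S. S \<subseteq> X \<and> order_chain S}"
  let ?J = "\<lambda>k. {S. S \<subseteq> X \<and> order_chain S \<and> card S = k}"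
  have finI: "finite ?I" using fin by simp
  have "(\<Sum>S\<in>?I. (-1) ^ card S) = (\<Sum>k\<le>n. \<Sum>S | S \<in> ?I \<and> card S = k. (-1) ^ card S :: int)"
    by (rule sum.group[symmetric]) (use finI bound in auto)
  also have "\<dots> = (\<Sum>k\<le>n. (-1) ^ k * int (card (?J k)))"
    by (intro sum.cong refl) (simp add: conj_assoc mult.commute)
  finally have "(-1) ^ n * (\<Sum>S\<in>?I. (-1) ^ card S) = (\<Sum>k\<le>n. (-1) ^ (n - k) * int (card (?J k)))"
    by (simp add: sum_distrib_left neg_one_power_add_eq_neg_one_power_diff flip: mult.assoc power_add)
  also have "\<dots> \<ge> 0" using alternating_sum_chains_eq_dim[OF fin acyc order.refl] by simp
  finally show ?thesis .
qed

section \<open>Rank selection\<close>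

context finite_graded_bounded_poset
begin

text \<open>Ranks are prescribed only along covers. An intermediate element splits the interval into
  two with smaller interiors.\<close>

lemma rk_strict_mono: "s \<in> P \<Longrightarrow> t \<in> P \<Longrightarrow> s < t \<Longrightarrow> rk s < rk t"
proof (induction "card {w \<in> P. s < w \<and> w < t}" arbitrary: s t rule: less_induct)
  case less
  show ?case
  proof (cases "poset_covers P s t")
    case True
    then show ?thesis using rk_covers by fastforce
  next
    case False
    then obtain w where w: "w \<in> P" "s < w" "w < t" using less.prems by (auto simp: poset_covers_def)
    have "card {v \<in> P. s < v \<and> v < w} < card {v \<in> P. s < v \<and> v < t}"
      by (rule psubset_card_mono) (use finite_carrier w in auto)
    moreover have "card {v \<in> P. w < v \<and> v < t} < card {v \<in> P. s < v \<and> v < t}"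
      by (rule psubset_card_mono) (use finite_carrier w in auto)
    ultimately show ?thesis
      using less.hyps[OF _ less.prems(1) w(1,2)] less.hyps[OF _ w(1) less.prems(2) w(3)] by linarith
  qed
qed

lemma rk_mono: "s \<in> P \<Longrightarrow> t \<in> P \<Longrightarrow> s \<le> t \<Longrightarrow> rk s \<le> rk t"
  using rk_strict_mono[of s t] by (auto simp: le_less)

definition rank_selection :: "'a \<Rightarrow> 'a \<Rightarrow> nat set \<Rightarrow> 'a set" where
  "rank_selection s t T = {w \<in> P. s < w \<and> w < t \<and> rk w \<in> T}"

lemma inj_on_rk_chain:
  assumes "C \<subseteq> P" "order_chain C"
  shows "inj_on rk C"
proof (rule inj_onI)
  fix x y assume xy: "x \<in> C" "y \<in> C" "rk x = rk y"
  then have "x \<le> y \<or> y \<le> x" using assms(2) by (auto simp: Complete_Partial_Order.chain_def)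
  then show "x = y"
    using rk_strict_mono[of x y] rk_strict_mono[of y x] xy assms(1) by (auto simp: le_less)
qed

lemma card_chain_rank_selection:
  assumes "finite T" "C \<subseteq> rank_selection s t T" "order_chain C"
  shows "card C \<le> card T"
  using assms inj_on_rk_chain[of C]
  by (intro card_inj_on_le[of rk]) (auto simp: rank_selection_def)

text \<open>The ranks outside \<open>T\<close> are removed one at a time; the link of an element of the removed
  rank is a join of two rank selections missing fewer ranks.\<close>

theorem acyclic_below_rank_selection:
  assumes acyc: "\<And>s t. s \<in> P \<Longrightarrow> t \<in> P \<Longrightarrow> s < t \<Longrightarrow>
      acyclic_below {w \<in> P. s < w \<and> w < t} (rk t - rk s - 1)"
  shows "s \<in> P \<Longrightarrow> t \<in> P \<Longrightarrow> s < t \<Longrightarrow> T \<subseteq> {rk s<..<rk t} \<Longrightarrow>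
    acyclic_below (rank_selection s t T) (card T)"
proof (induction "card ({rk s<..<rk t} - T)" arbitrary: s t T rule: less_induct)
  case less
  note st = less.prems(1-3) and T = less.prems(4)
  show ?case
  proof (cases "T = {rk s<..<rk t}")
    case True
    then have "rank_selection s t T = {w \<in> P. s < w \<and> w < t}"
      using rk_strict_mono st by (auto simp: rank_selection_def)
    then show ?thesis using acyc[OF st] True by simp
  next
    case False
    then obtain i where i: "i \<in> {rk s<..<rk t}" "i \<notin> T" using T by blast
    have finT: "finite T" using finite_subset[OF T] by simp
    let ?X = "rank_selection s t T" and ?I = "rank_selection s t {i}"
    have fin: "finite (rank_selection s' t' T')" for s' t' T'
      using finite_carrier by (simp add: rank_selection_def)
    \<comment> \<open>In each use of the induction hypothesis the missing ranks are among the
      present ones, without \<open>i\<close>: it is either restored to \<open>T\<close> or the rank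
      of an endpoint.\<close>
    have fewer: "card A < card ({rk s<..<rk t} - T)" if "A \<subseteq> {rk s<..<rk t} - T" "i \<notin> A" for A
      by (rule psubset_card_mono) (use that i in auto)
    show ?thesis
    proof (rule acyclic_below_remove_antichain[OF fin fin])
      show "?X \<inter> ?I = {}" using i by (auto simp: rank_selection_def)
      show "x = y" if "x \<in> ?I" "y \<in> ?I" "x \<le> y" for x y
        using that rk_strict_mono[of x y] by (auto simp: rank_selection_def le_less)
      have "card ({rk s<..<rk t} - insert i T) < card ({rk s<..<rk t} - T)"
        by (rule fewer) auto
      then have "acyclic_below (rank_selection s t (insert i T)) (card (insert i T))"
        by (rule less.hyps[OF _ st]) (use T i in auto)
      moreover have "rank_selection s t (insert i T) = ?X \<union> ?I" by (auto simp: rank_selection_def)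
      ultimately show "acyclic_below (?X \<union> ?I) (Suc (card T))" using i finT by simp
    next
      fix x assume "x \<in> ?I"
      then have x: "x \<in> P" "s < x" "x < t" "rk x = i" by (auto simp: rank_selection_def)
      let ?T1 = "T \<inter> {..<i}" and ?T2 = "T \<inter> {i<..}"
      let ?A = "rank_selection s x ?T1" and ?B = "rank_selection x t ?T2"
      have T12: "?T1 \<subseteq> {rk s<..<rk x}" "?T2 \<subseteq> {rk x<..<rk t}" using T x(4) by auto
      have "card ({rk s<..<rk x} - ?T1) < card ({rk s<..<rk t} - T)"
        by (rule fewer) (use i x(4) in auto)
      then have A: "acyclic_below ?A (card ?T1)" using less.hyps[OF _ st(1) x(1,2) T12(1)] by blast
      have "card ({rk x<..<rk t} - ?T2) < card ({rk s<..<rk t} - T)"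
        by (rule fewer) (use i x(4) in auto)
      then have B: "acyclic_below ?B (card ?T2)" using less.hyps[OF _ x(1) st(2) x(3) T12(2)] by blast
      interpret poset_join ?A ?B
        by (unfold_locales, rule fin, rule fin) (auto simp: rank_selection_def)
      have "acyclic_below (?A \<union> ?B) (card ?T1 + card ?T2)"
        by (rule acyclic_below_join[OF A B], rule card_chain_rank_selection) (use finT in auto)
      moreover have "?A \<union> ?B = {y \<in> ?X. y < x \<or> x < y}"
      proof -
        have "rk y < i" if "y \<in> P" "y < x" for y using rk_strict_mono[OF that(1) x(1) that(2)] x(4) by simp
        moreover have "i < rk y" if "y \<in> P" "x < y" for y using rk_strict_mono[OF x(1) that] x(4) by simp
        moreover have "y < t" if "y < x" for y using that x(3) by (rule less_trans)
        moreover have "s < y" if "x < y" for y using x(2) that by (rule less_trans)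
        ultimately show ?thesis unfolding rank_selection_def by blast
      qed
      moreover have "card ?T1 + card ?T2 = card T"
      proof -
        have "x < i \<or> i < x" if "x \<in> T" for x using that i(2) by (metis nat_neq_iff)
        then have "?T1 \<union> ?T2 = T" by auto
        moreover have "?T1 \<inter> ?T2 = {}" by auto
        ultimately show ?thesis using card_Un_disjoint[of ?T1 ?T2] finT by simp
      qed
      ultimately show "acyclic_below {y \<in> ?X. y < x \<or> x < y} (card T)" by simp
    qed
  qed
qed

end

section \<open>Homology of increasing lists\<close>

lemma order_chain_set_sorted: "sorted_wrt (<) c \<Longrightarrow> order_chain (set c)" for c :: "'a::order list"
  by (induction c) (auto intro!: order_chain_insert simp: less_imp_le Complete_Partial_Order.chain_empty)

lemma sorted_wrt_less_distinct: "sorted_wrt (<) c \<Longrightarrow> distinct c" for c :: "'a::order list"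
  by (induction c) auto

text \<open>Two different heads would each lie strictly below the other.\<close>

lemma sorted_wrt_less_unique:
  fixes c d :: "'a::order list"
  shows "sorted_wrt (<) c \<Longrightarrow> sorted_wrt (<) d \<Longrightarrow> set c = set d \<Longrightarrow> c = d"
proof (induction c arbitrary: d)
  case Nil
  then show ?case by simp
next
  case (Cons x c)
  then obtain y d' where d: "d = y # d'" by (cases d) auto
  have "x = y"
  proof (rule ccontr)
    assume "x \<noteq> y"
    then have "x \<in> set d'" "y \<in> set c" using Cons.prems(3) d by auto
    then show False using Cons.prems(1,2) d by (auto dest: less_asym)
  qed
  moreover have "x \<notin> set c" "y \<notin> set d'" using Cons.prems(1,2) d by auto
  ultimately have "set c = set d'" using Cons.prems(3) d by auto
  then show ?case using Cons.IH[of d'] Cons.prems(1,2) d \<open>x = y\<close> by simp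
qed

lemma order_chain_sorted_list:
  assumes "finite C" "order_chain C"
  shows "\<exists>c. sorted_wrt (<) c \<and> set c = C"
  using assms
proof (induction "card C" arbitrary: C)
  case 0
  then show ?case by (intro exI[of _ "[]"]) auto
next
  case (Suc n)
  then have "C \<noteq> {}" by auto
  then obtain m where m: "m \<in> C" "\<And>x. x \<in> C \<Longrightarrow> \<not> x < m"
    using finite_has_minimal[OF Suc.prems(1)] by (metis less_le)
  have "order_chain (C - {m})" using Suc.prems(2) by (rule order_chain_subset) auto
  moreover have "n = card (C - {m})"
    using m(1) Suc.prems(1) by (simp flip: Suc.hyps(2))
  ultimately obtain c where c: "sorted_wrt (<) c" "set c = C - {m}"
    using Suc.hyps(1)[of "C - {m}"] Suc.prems(1) by auto
  have "m < x" if "x \<in> C - {m}" for x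
    using that m Suc.prems(2) by (auto simp: Complete_Partial_Order.chain_def less_le)
  then show ?case using c m(1) by (intro exI[of _ "m # c"]) auto
qed

lemma order_simplicesD:
  assumes "c \<in> order_simplices X i"
  shows "set c \<subseteq> X" "sorted_wrt (<) c" "int (length c) = i + 1"
  using assms by (auto simp: order_simplices_def)

lemma finite_order_simplices: "finite X \<Longrightarrow> finite (order_simplices X i)"
  by (rule finite_subset[OF _ finite_lists_length_eq[of X "nat (i + 1)"]])
    (auto simp: order_simplices_def)

lemma order_simplices_set:
  assumes "c \<in> order_simplices X (int k - 1)"
  shows "set c \<subseteq> X" "order_chain (set c)" "card (set c) = k"
  using order_simplicesD[OF assms]
  by (auto simp: order_chain_set_sorted distinct_card sorted_wrt_less_distinct)

lemma delete_nth_distinct: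
  assumes "distinct c" "j < length c"
  shows "set c = insert (c ! j) (set (take j c @ drop (Suc j) c))"
    and "c ! j \<notin> set (take j c @ drop (Suc j) c)"
proof -
  have e: "take j c @ c ! j # drop (Suc j) c = c" using id_take_nth_drop[OF assms(2)] by (rule sym)
  have "set (take j c @ c ! j # drop (Suc j) c) = insert (c ! j) (set (take j c @ drop (Suc j) c))" by auto
  then show "set c = insert (c ! j) (set (take j c @ drop (Suc j) c))" unfolding e .
  have "distinct (take j c @ c ! j # drop (Suc j) c)" unfolding e by (rule assms(1))
  then show "c ! j \<notin> set (take j c @ drop (Suc j) c)" by auto
qed

lemma sorted_wrt_delete_nth: "sorted_wrt R c \<Longrightarrow> sorted_wrt R (take j c @ drop (Suc j) c)"
proof -
  assume c: "sorted_wrt R c"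
  then have "sorted_wrt R (take j c @ drop j c)" by simp
  moreover have "set (drop (Suc j) c) \<subseteq> set (drop j c)" by (rule set_drop_subset_set_drop) simp
  moreover have "sorted_wrt R (drop (Suc j) c)" using c by (rule sorted_wrt_drop)
  ultimately show ?thesis unfolding sorted_wrt_append by blast
qed

text \<open>The exponent in \<open>removal_sign\<close> is thus the position \<open>j\<close>, and
  the two sign conventions agree.\<close>

lemma sorted_smaller_than_nth:
  fixes c :: "'a::order list"
  assumes "sorted_wrt (<) c" "j < length c"
  shows "{s \<in> set (take j c @ drop (Suc j) c). s < c ! j} = set (take j c)"
proof -
  have "x < c ! j" if "x \<in> set (take j c)" for x
    using that assms by (auto simp: in_set_conv_nth sorted_wrt_nth_less)
  moreover have "\<not> x < c ! j" if x: "x \<in> set (drop (Suc j) c)" for x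
  proof -
    obtain i where "i < length (drop (Suc j) c)" "drop (Suc j) c ! i = x"
      using x unfolding in_set_conv_nth by blast
    then have "x = c ! Suc (j + i)" "i < length c - Suc j" using assms(2) by auto
    then have "c ! j < x" using sorted_wrt_nth_less[OF assms(1), of j "Suc (j + i)"] by simp
    then show ?thesis by (rule less_not_sym)
  qed
  ultimately show ?thesis by auto
qed

text \<open>Simplices are increasing lists in the definition of homology, and their underlying sets here.\<close>

definition list_chain :: "'a::order set \<Rightarrow> nat \<Rightarrow> ('a set \<Rightarrow> rat) \<Rightarrow> 'a list \<Rightarrow> rat" where
  "list_chain X k f = (\<lambda>c. if c \<in> order_simplices X (int k - 1) then f (set c) else 0)"

text \<open>Both sides sum over the ways to enlarge \<open>d\<close> by one vertex: a list
  \<open>c\<close> with position \<open>j\<close> corresponds to the vertex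
  \<open>y = c ! j\<close>.\<close>

lemma boundary_map_list_chain:
  assumes fin: "finite X" and f: "f \<in> set_chains X k"
  shows "boundary_map X (int k - 1) (list_chain X k f) d =
    (if set d \<subseteq> X \<and> sorted_wrt (<) d then set_boundary X f (set d) else 0)"
proof -
  let ?O = "order_simplices X (int k - 1)"
  let ?del = "\<lambda>c j. take j c @ drop (Suc j) c"
  define I where "I = {(c, j). c \<in> ?O \<and> j < length c \<and> ?del c j = d}"
  have finO: "finite ?O" using fin by (rule finite_order_simplices)
  have "boundary_map X (int k - 1) (list_chain X k f) d =
      (\<Sum>(c, j)\<in>Sigma ?O (\<lambda>c. {..<length c}). if ?del c j = d then (-1) ^ j * f (set c) else 0)"
    unfolding boundary_map_def list_chain_def
    by (subst sum.Sigma[symmetric]) (use finO in \<open>auto intro!: sum.cong\<close>)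
  also have "\<dots> = (\<Sum>(c, j)\<in>I. (-1) ^ j * f (set c))"
    by (rule sum.mono_neutral_cong_right) (use finO in \<open>auto simp: I_def split: if_splits\<close>)
  finally have lhs: "boundary_map X (int k - 1) (list_chain X k f) d = (\<Sum>(c, j)\<in>I. (-1) ^ j * f (set c))" .
  show ?thesis
  proof (cases "set d \<subseteq> X \<and> sorted_wrt (<) d")
    case False
    have "I = {}"
    proof (rule ccontr)
      assume "I \<noteq> {}"
      then obtain c j where c: "c \<in> ?O" "?del c j = d" by (auto simp: I_def)
      note D = order_simplicesD[OF c(1)]
      have "set d \<subseteq> X"
        unfolding c(2)[symmetric] set_append
        using D(1) set_take_subset[of j c] set_drop_subset[of "Suc j" c] by blast
      moreover have "sorted_wrt (<) d" using sorted_wrt_delete_nth[OF D(2), of j] unfolding c(2) .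
      ultimately show False using False by simp
    qed
    then show ?thesis using lhs by (simp only: False sum.empty if_False)
  next
    case True
    \<comment> \<open>A nonzero coefficient ensures that \<open>insert y (set d)\<close> is a chain,
      so that it has an increasing list.\<close>
    let ?J = "{y \<in> X - set d. f (insert y (set d)) \<noteq> 0}"
    have I_sets: "set c = insert (c ! j) (set d)" "c ! j \<notin> set d" "j = card {s \<in> set d. s < c ! j}"
      "c ! j \<in> X" if "(c, j) \<in> I" for c j
    proof -
      have c: "c \<in> ?O" "j < length c" "?del c j = d" using that by (auto simp: I_def)
      note D = order_simplicesD[OF c(1)]
      have dist: "distinct c" using D(2) by (rule sorted_wrt_less_distinct)
      show "set c = insert (c ! j) (set d)" "c ! j \<notin> set d"
        using delete_nth_distinct[OF dist c(2)] unfolding c(3) .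
      show "c ! j \<in> X" using D(1) c(2) by auto
      have "card (set (take j c)) = j" using dist c(2) by (simp add: distinct_card)
      then show "j = card {s \<in> set d. s < c ! j}"
        using sorted_smaller_than_nth[OF D(2) c(2)] c(3) by simp
    qed
    have "(\<Sum>(c, j)\<in>I. (-1) ^ j * f (set c)) = (\<Sum>(c, j)\<in>{(c, j) \<in> I. f (set c) \<noteq> 0}. (-1) ^ j * f (set c))"
    proof (rule sum.mono_neutral_right)
      show "finite I"
        by (rule finite_subset[of _ "Sigma ?O (\<lambda>c. {..<length c})"]) (use finO in \<open>auto simp: I_def\<close>)
    qed auto
    also have "\<dots> = (\<Sum>y\<in>?J. removal_sign y (set d) * f (insert y (set d)))"
    proof (rule sum.reindex_cong[of "\<lambda>(c, j). c ! j", symmetric])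
      show "inj_on (\<lambda>(c, j). c ! j) {(c, j) \<in> I. f (set c) \<noteq> 0}"
      proof (rule inj_onI, clarify)
        fix c j c' j' assume a: "(c, j) \<in> I" "(c', j') \<in> I" "c ! j = c' ! j'"
        have "set c = set c'" using I_sets(1)[OF a(1)] I_sets(1)[OF a(2)] a(3) by simp
        moreover have "sorted_wrt (<) c" "sorted_wrt (<) c'"
          using a(1,2) order_simplicesD(2) by (auto simp: I_def)
        ultimately have "c = c'" by (intro sorted_wrt_less_unique)
        moreover have "j = j'" using I_sets(3)[OF a(1)] I_sets(3)[OF a(2)] a(3) by simp
        ultimately show "c = c' \<and> j = j'" by simp
      qed
    next
      show "?J = (\<lambda>(c, j). c ! j) ` {(c, j) \<in> I. f (set c) \<noteq> 0}"
      proof (intro equalityI subsetI)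
        fix y assume "y \<in> ?J"
        then have y: "y \<in> X" "y \<notin> set d" "f (insert y (set d)) \<noteq> 0" by auto
        note D = set_chainsD[OF f y(3)]
        obtain c where c: "sorted_wrt (<) c" "set c = insert y (set d)"
          using order_chain_sorted_list[OF finite_subset[OF D(1) fin] D(2)] by blast
        obtain j where j: "j < length c" "c ! j = y"
          using c(2) by (metis in_set_conv_nth insertI1)
        have dist: "distinct c" using c(1) by (rule sorted_wrt_less_distinct)
        have cO: "c \<in> ?O"
          using c D distinct_card[OF dist] by (auto simp: order_simplices_def)
        have "sorted_wrt (<) (?del c j)" using c(1) by (rule sorted_wrt_delete_nth)
        moreover have "set (?del c j) = set d"
          using delete_nth_distinct[OF dist j(1)] c(2) y(2) unfolding j(2) by (metis insert_ident)
        ultimately have "?del c j = d" using True by (intro sorted_wrt_less_unique) auto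
        then have "(c, j) \<in> {(c, j) \<in> I. f (set c) \<noteq> 0}" using cO j y(3) c(2) by (auto simp: I_def)
        then show "y \<in> (\<lambda>(c, j). c ! j) ` {(c, j) \<in> I. f (set c) \<noteq> 0}" using j(2) by force
      next
        fix y assume "y \<in> (\<lambda>(c, j). c ! j) ` {(c, j) \<in> I. f (set c) \<noteq> 0}"
        then obtain c j where cj: "(c, j) \<in> I" "f (set c) \<noteq> 0" "y = c ! j" by auto
        then show "y \<in> ?J" using I_sets[OF cj(1)] by simp
      qed
    next
      fix x assume "x \<in> {(c, j) \<in> I. f (set c) \<noteq> 0}"
      then obtain c j where cj: "x = (c, j)" "(c, j) \<in> I" by auto
      then show "removal_sign (case x of (c, j) \<Rightarrow> c ! j) (set d) *
          f (insert (case x of (c, j) \<Rightarrow> c ! j) (set d)) = (case x of (c, j) \<Rightarrow> (-1) ^ j * f (set c))"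
        using I_sets(1,3)[OF cj(2)] by (simp add: removal_sign_def)
    qed
    also have "\<dots> = set_boundary X f (set d)"
      unfolding set_boundary_def by (rule sum.mono_neutral_left) (use fin in auto)
    finally show ?thesis using lhs True by simp
  qed
qed

lemma list_chain_in: "list_chain X k f \<in> simplicial_chains X (int k - 1)"
  by (auto simp: list_chain_def simplicial_chains_def)

lemma simplicial_chains_eq_list_chain:
  assumes fin: "finite X" and w: "w \<in> simplicial_chains X (int k - 1)"
  obtains f where "f \<in> set_chains X k" "w = list_chain X k f"
proof -
  define f where "f = (\<lambda>S. if S \<subseteq> X \<and> order_chain S \<and> card S = k
    then w (SOME c. sorted_wrt (<) c \<and> set c = S) else 0)"
  have "f \<in> set_chains X k" by (auto simp: f_def set_chains_def)
  moreover have "w = list_chain X k f"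
  proof
    fix c
    show "w c = list_chain X k f c"
    proof (cases "c \<in> order_simplices X (int k - 1)")
      case True
      have "sorted_wrt (<) (SOME c'. sorted_wrt (<) c' \<and> set c' = set c) \<and>
          set (SOME c'. sorted_wrt (<) c' \<and> set c' = set c) = set c"
        by (rule someI[of _ c]) (use order_simplicesD[OF True] in simp)
      then have "(SOME c'. sorted_wrt (<) c' \<and> set c' = set c) = c"
        using order_simplicesD(2)[OF True] sorted_wrt_less_unique by blast
      then show ?thesis using order_simplices_set[OF True] True by (simp add: list_chain_def f_def)
    next
      case False
      then show ?thesis using w by (simp add: list_chain_def simplicial_chains_def)
    qed
  qed
  ultimately show ?thesis using that by blast
qed

text \<open>The class of \<open>z\<close> belongs to the quotient, whose only element is the set of
  boundaries, and \<open>z\<close> lies in its own class because zero is a boundary.\<close>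

lemma simplicial_cycle_is_boundary:
  assumes "reduced_homology X i = {simplicial_boundaries X i}" and "z \<in> simplicial_cycles X i"
  shows "z \<in> simplicial_boundaries X i"
proof -
  let ?R = "{(z, w). z \<in> simplicial_cycles X i \<and> w \<in> simplicial_cycles X i \<and>
        (\<lambda>c. z c - w c) \<in> simplicial_boundaries X i}"
  have "boundary_map X (i + 1) (\<lambda>c. 0) = (\<lambda>c. 0)"
    by (rule ext) (auto simp: boundary_map_def intro!: sum.neutral)
  moreover have "(\<lambda>c. 0) \<in> simplicial_chains X (i + 1)" by (simp add: simplicial_chains_def)
  ultimately have "(\<lambda>c. 0) \<in> simplicial_boundaries X i"
    unfolding simplicial_boundaries_def by (metis image_eqI)
  then have "z \<in> ?R `` {z}" using assms(2) by simp
  moreover have "?R `` {z} \<in> reduced_homology X i"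
    unfolding reduced_homology_def using assms(2) by (rule quotientI)
  ultimately show ?thesis unfolding assms(1) by blast
qed

text \<open>Size \<open>k\<close> is dimension \<open>k - 1\<close>. A filling of the list version
  of a cycle is itself the list version of a filling, and values on increasing lists determine a
  chain.\<close>

lemma acyclic_below_if_reduced_homology:
  assumes fin: "finite X"
    and hom: "\<And>k. k < n \<Longrightarrow> reduced_homology X (int k - 1) = {simplicial_boundaries X (int k - 1)}"
  shows "acyclic_below X n"
  unfolding acyclic_below_def
proof (intro allI impI ballI)
  fix k z assume k: "k < n" and z: "z \<in> set_chains X k" "set_boundary X z = 0"
  have "list_chain X k z \<in> simplicial_cycles X (int k - 1)"
    unfolding simplicial_cycles_def
    using list_chain_in boundary_map_list_chain[OF fin z(1)] z(2) by auto
  then have "list_chain X k z \<in> simplicial_boundaries X (int k - 1)"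
    by (rule simplicial_cycle_is_boundary[OF hom[OF k]])
  then obtain w' where w': "w' \<in> simplicial_chains X (int (Suc k) - 1)"
    "boundary_map X (int (Suc k) - 1) w' = list_chain X k z"
    unfolding simplicial_boundaries_def by auto
  obtain w where w: "w \<in> set_chains X (Suc k)" "w' = list_chain X (Suc k) w"
    by (rule simplicial_chains_eq_list_chain[OF fin w'(1)])
  have wb: "set_boundary X w \<in> set_chains X k" using w(1) fin by (rule set_boundary_in)
  have "set_boundary X w S = z S" for S
  proof (cases "S \<subseteq> X \<and> order_chain S \<and> card S = k")
    case True
    then obtain d where d: "sorted_wrt (<) d" "set d = S"
      using order_chain_sorted_list finite_subset[OF _ fin] by metis
    have "length d = k" using True d distinct_card[OF sorted_wrt_less_distinct] by metis
    then have "d \<in> order_simplices X (int k - 1)" using True d by (simp add: order_simplices_def)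
    then have "z S = boundary_map X (int (Suc k) - 1) w' d"
      unfolding w'(2) using d by (simp add: list_chain_def)
    also have "\<dots> = set_boundary X w S"
      unfolding w(2) boundary_map_list_chain[OF fin w(1)] using d True by simp
    finally show ?thesis by simp
  next
    case False
    then have "z S = 0" "set_boundary X w S = 0"
      using set_chainsD[OF z(1), of S] set_chainsD[OF wb, of S] by blast+
    then show ?thesis by simp
  qed
  then show "\<exists>w\<in>set_chains X (Suc k). set_boundary X w = z" using w(1) by blast
qed

section \<open>Incidence algebra and the recursion for the Chow function\<close>

text \<open>\<open>chow_gap d\<close> is \<open>x + x^2 + \<dots> + x^(d-1)\<close>.\<close>

primrec chow_gap :: "nat \<Rightarrow> int poly" where
  "chow_gap 0 = 0"
| "chow_gap (Suc d) = (if d = 0 then 0 else [:0, 1:] * chow_gap d + [:0, 1:])"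

text \<open>A geometric sum. It identifies \<open>chow_gap d\<close> with the entry of \<zeta>
  \<chi>bar at rank difference \<open>d\<close>.\<close>

lemma chow_gap_mult: "0 < d \<Longrightarrow> [:-1, 1:] * chow_gap d = monom 1 d - [:0, 1:]"
proof (induction d)
  case (Suc d)
  show ?case
  proof (cases "d = 0")
    case True
    then show ?thesis by (simp add: monom_Suc monom_0)
  next
    case False
    have "[:-1, 1:] * chow_gap (Suc d) = [:0, 1:] * ([:-1, 1:] * chow_gap d) + [:-1, 1:] * [:0, 1:]"
      using False by (simp only: chow_gap.simps if_False) (simp only: algebra_simps)
    also have "\<dots> = [:0, 1:] * monom 1 d - [:0, 1:]"
      using Suc False by (simp add: algebra_simps)
    also have "[:0, 1:] * monom 1 d = monom (1 :: int) (Suc d)" by (simp add: monom_Suc)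
    finally show ?thesis .
  qed
qed simp

section \<open>Inverses in the incidence algebra\<close>

context finite_graded_bounded_poset
begin

abbreviation incidence :: "('a \<Rightarrow> 'a \<Rightarrow> int poly) ring" where
  "incidence \<equiv> incidence_algebra P"

lemma incidence_carrier:
  "a \<in> carrier incidence \<longleftrightarrow> (\<forall>s t. \<not> (s \<in> P \<and> t \<in> P \<and> s \<le> t) \<longrightarrow> a s t = 0)"
  by (simp add: incidence_algebra_def)

lemma incidence_one: "\<one>\<^bsub>incidence\<^esub> = (\<lambda>s t. if s \<in> P \<and> s = t then 1 else 0)"
  by (simp add: incidence_algebra_def)

lemma incidence_zero: "\<zero>\<^bsub>incidence\<^esub> = (\<lambda>s t. 0)"
  by (simp add: incidence_algebra_def)

lemma incidence_add: "a \<oplus>\<^bsub>incidence\<^esub> b = (\<lambda>s t. a s t + b s t)"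
  by (simp add: incidence_algebra_def)

lemma incidence_mult_def:
  "(a \<otimes>\<^bsub>incidence\<^esub> b) s t = (\<Sum>w\<in>{w \<in> P. s \<le> w \<and> w \<le> t}. a s w * b w t)"
  by (simp add: incidence_algebra_def)

text \<open>Summation over all of \<open>P\<close> makes the double sums in associativity
  rectangular, so that they can be swapped.\<close>

lemma incidence_mult:
  assumes "a \<in> carrier incidence" "b \<in> carrier incidence"
  shows "(a \<otimes>\<^bsub>incidence\<^esub> b) s t = (\<Sum>w\<in>P. a s w * b w t)"
  unfolding incidence_mult_def
proof (rule sum.mono_neutral_left)
  show "\<forall>w\<in>P - {w \<in> P. s \<le> w \<and> w \<le> t}. a s w * b w t = 0"
    using assms by (auto simp: incidence_carrier)
qed (use finite_carrier in auto)

lemma incidence_mult_closed: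
  assumes a: "a \<in> carrier incidence" and b: "b \<in> carrier incidence"
  shows "a \<otimes>\<^bsub>incidence\<^esub> b \<in> carrier incidence"
  unfolding incidence_carrier
proof (intro allI impI)
  fix s t assume st: "\<not> (s \<in> P \<and> t \<in> P \<and> s \<le> t)"
  have "a s w * b w t = 0" if "w \<in> P" for w
  proof (cases "s \<in> P \<and> s \<le> w")
    case True
    then have "\<not> (w \<in> P \<and> t \<in> P \<and> w \<le> t)" using st by (meson order_trans)
    then show ?thesis using b unfolding incidence_carrier by simp
  next
    case False
    then show ?thesis using a unfolding incidence_carrier by simp
  qed
  then show "(a \<otimes>\<^bsub>incidence\<^esub> b) s t = 0" unfolding incidence_mult[OF a b] by (rule sum.neutral[OF ballI])
qed

lemma incidence_monoid: "Group.monoid incidence"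
proof (rule Group.monoidI)
  show one: "\<one>\<^bsub>incidence\<^esub> \<in> carrier incidence"
    by (auto simp: incidence_carrier incidence_one)
  show "x \<otimes>\<^bsub>incidence\<^esub> y \<in> carrier incidence"
    if "x \<in> carrier incidence" "y \<in> carrier incidence" for x y
    using that by (rule incidence_mult_closed)
  show "\<one>\<^bsub>incidence\<^esub> \<otimes>\<^bsub>incidence\<^esub> x = x" if x: "x \<in> carrier incidence" for x
  proof (intro ext)
    fix s t
    have "(\<one>\<^bsub>incidence\<^esub> \<otimes>\<^bsub>incidence\<^esub> x) s t = (\<Sum>w\<in>P. if w = s then x s t else 0)"
      unfolding incidence_mult[OF one x] by (rule sum.cong) (auto simp: incidence_one)
    also have "\<dots> = x s t"
      using finite_carrier x by (auto simp: incidence_carrier)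
    finally show "(\<one>\<^bsub>incidence\<^esub> \<otimes>\<^bsub>incidence\<^esub> x) s t = x s t" .
  qed
  show "x \<otimes>\<^bsub>incidence\<^esub> \<one>\<^bsub>incidence\<^esub> = x" if x: "x \<in> carrier incidence" for x
  proof (intro ext)
    fix s t
    have "(x \<otimes>\<^bsub>incidence\<^esub> \<one>\<^bsub>incidence\<^esub>) s t = (\<Sum>w\<in>P. if w = t then x s t else 0)"
      unfolding incidence_mult[OF x one] by (rule sum.cong) (auto simp: incidence_one)
    also have "\<dots> = x s t"
      using finite_carrier x by (auto simp: incidence_carrier)
    finally show "(x \<otimes>\<^bsub>incidence\<^esub> \<one>\<^bsub>incidence\<^esub>) s t = x s t" .
  qed
  show "x \<otimes>\<^bsub>incidence\<^esub> y \<otimes>\<^bsub>incidence\<^esub> z = x \<otimes>\<^bsub>incidence\<^esub> (y \<otimes>\<^bsub>incidence\<^esub> z)"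
    if x: "x \<in> carrier incidence" and y: "y \<in> carrier incidence" and z: "z \<in> carrier incidence" for x y z
  proof (intro ext)
    fix s t
    have "(x \<otimes>\<^bsub>incidence\<^esub> y \<otimes>\<^bsub>incidence\<^esub> z) s t = (\<Sum>w\<in>P. \<Sum>v\<in>P. x s v * y v w * z w t)"
      unfolding incidence_mult[OF incidence_mult_closed[OF x y] z] incidence_mult[OF x y]
      by (simp add: sum_distrib_right)
    also have "\<dots> = (\<Sum>v\<in>P. \<Sum>w\<in>P. x s v * y v w * z w t)" by (rule sum.swap)
    also have "\<dots> = (x \<otimes>\<^bsub>incidence\<^esub> (y \<otimes>\<^bsub>incidence\<^esub> z)) s t"
      unfolding incidence_mult[OF x incidence_mult_closed[OF y z]] incidence_mult[OF y z]
      by (simp add: sum_distrib_left mult.assoc)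
    finally show "(x \<otimes>\<^bsub>incidence\<^esub> y \<otimes>\<^bsub>incidence\<^esub> z) s t = (x \<otimes>\<^bsub>incidence\<^esub> (y \<otimes>\<^bsub>incidence\<^esub> z)) s t" .
  qed
qed

lemma incidence_a_inv:
  assumes a: "a \<in> carrier incidence"
  shows "\<ominus>\<^bsub>incidence\<^esub> a = (\<lambda>s t. - a s t)"
proof -
  have "abelian_group incidence"
  proof (rule abelian_groupI)
    fix x assume "x \<in> carrier incidence"
    then show "\<exists>y\<in>carrier incidence. y \<oplus>\<^bsub>incidence\<^esub> x = \<zero>\<^bsub>incidence\<^esub>"
      by (intro bexI[of _ "\<lambda>s t. - x s t"]) (auto simp: incidence_carrier incidence_add incidence_zero)
  qed (auto simp: incidence_carrier incidence_add incidence_zero add_ac)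
  then interpret abelian_group incidence .
  show ?thesis
    by (rule minus_equality) (use a in \<open>auto simp: incidence_carrier incidence_add incidence_zero\<close>)
qed

text \<open>The system for \<open>b\<close> is triangular: the entry at \<open>s\<close> and
  \<open>t\<close> depends on entries at \<open>w\<close> and \<open>t\<close> with \<open>w\<close>
  above \<open>s\<close>. A diagonal entry that squares to one is its own inverse.\<close>

lemma incidence_right_inverse:
  assumes a: "a \<in> carrier incidence" and diag: "\<And>s. s \<in> P \<Longrightarrow> a s s * a s s = 1"
  shows "\<exists>b\<in>carrier incidence. a \<otimes>\<^bsub>incidence\<^esub> b = \<one>\<^bsub>incidence\<^esub> \<and> (\<forall>s\<in>P. b s s = a s s)"
proof -
  define F where "F = (\<lambda>b s t. if s \<in> P \<and> t \<in> P \<and> s \<le> t then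
    a s s * ((if s = t then 1 else 0) - (\<Sum>w\<in>{w \<in> P. s < w \<and> w \<le> t}. a s w * b w t)) else 0)"
  define B where "B = (\<lambda>n. (F ^^ n) (\<lambda>s t. 0))"
  have B_Suc: "B (Suc n) = F (B n)" for n by (simp add: B_def)
  \<comment> \<open>\<open>F\<close> looks up by at least one rank, so an entry is final once the
    number of iterations exceeds its rank difference.\<close>
  have stable: "B (Suc n) s t = B n s t" if "s \<in> P" "t \<in> P" "s \<le> t" "rk t - rk s < n" for n s t
    using that
  proof (induction n arbitrary: s)
    case (Suc n)
    have "(\<Sum>w\<in>{w \<in> P. s < w \<and> w \<le> t}. a s w * B (Suc n) w t) =
        (\<Sum>w\<in>{w \<in> P. s < w \<and> w \<le> t}. a s w * B n w t)"
    proof (rule sum.cong[OF refl])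
      fix w assume "w \<in> {w \<in> P. s < w \<and> w \<le> t}"
      then have w: "w \<in> P" "s < w" "w \<le> t" by auto
      have "rk s < rk w" "rk w \<le> rk t"
        using rk_strict_mono[OF Suc.prems(1) w(1,2)] rk_mono[OF w(1) Suc.prems(2) w(3)] by auto
      then show "a s w * B (Suc n) w t = a s w * B n w t"
        using Suc.IH[OF w(1) Suc.prems(2) w(3)] Suc.prems(4) by simp
    qed
    then have "F (B (Suc n)) s t = F (B n) s t" unfolding F_def by simp
    then show ?case by (simp only: B_Suc)
  qed simp
  \<comment> \<open>No rank difference exceeds \<open>rk tp\<close>, so after
    \<open>Suc (rk tp)\<close> iterations all entries are final.\<close>
  define b where "b = B (Suc (rk tp))"
  have b_rec: "b s t = F b s t" if "s \<in> P" "t \<in> P" "s \<le> t" for s t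
  proof -
    have "rk t \<le> rk tp" using rk_mono that tp_in le_tp by simp
    then have "B (Suc (Suc (rk tp))) s t = b s t" unfolding b_def using that by (intro stable) auto
    then show ?thesis by (simp add: B_Suc b_def)
  qed
  have b_in: "b \<in> carrier incidence" by (auto simp: incidence_carrier b_def B_Suc F_def)
  have b_diag: "b s s = a s s" if s: "s \<in> P" for s
  proof -
    have "{w \<in> P. s < w \<and> w \<le> s} = {}" by auto
    then have "F b s s = a s s" using s by (simp only: F_def) simp
    then show ?thesis using b_rec[OF s s order.refl] by simp
  qed
  have "(a \<otimes>\<^bsub>incidence\<^esub> b) s t = \<one>\<^bsub>incidence\<^esub> s t" for s t
  proof (cases "s \<in> P \<and> t \<in> P \<and> s \<le> t")
    case True
    have "{w \<in> P. s \<le> w \<and> w \<le> t} = insert s {w \<in> P. s < w \<and> w \<le> t}"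
      using True by (auto simp: le_less)
    then have "(a \<otimes>\<^bsub>incidence\<^esub> b) s t = a s s * b s t + (\<Sum>w\<in>{w \<in> P. s < w \<and> w \<le> t}. a s w * b w t)"
      unfolding incidence_mult_def using finite_carrier by simp
    also have "a s s * b s t = (if s = t then 1 else 0) - (\<Sum>w\<in>{w \<in> P. s < w \<and> w \<le> t}. a s w * b w t)"
      using b_rec[of s t] True diag[of s] by (simp add: F_def flip: mult.assoc)
    finally show ?thesis using True by (simp add: incidence_one)
  next
    case False
    then show ?thesis
      using incidence_mult_closed[OF a b_in] by (auto simp: incidence_carrier incidence_one)
  qed
  then have "a \<otimes>\<^bsub>incidence\<^esub> b = \<one>\<^bsub>incidence\<^esub>" by (intro ext)
  then show ?thesis using b_in b_diag by blast
qed

text \<open>The right inverse has the same diagonal, hence a right inverse of its own, which in a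
  monoid must be \<open>a\<close>.\<close>

lemma incidence_Units:
  assumes a: "a \<in> carrier incidence" and diag: "\<And>s. s \<in> P \<Longrightarrow> a s s * a s s = 1"
  shows "a \<in> Units incidence"
proof -
  interpret Group.monoid incidence by (rule incidence_monoid)
  obtain b where b: "b \<in> carrier incidence" "a \<otimes>\<^bsub>incidence\<^esub> b = \<one>\<^bsub>incidence\<^esub>" "\<forall>s\<in>P. b s s = a s s"
    using incidence_right_inverse[OF a diag] by blast
  obtain c where c: "c \<in> carrier incidence" "b \<otimes>\<^bsub>incidence\<^esub> c = \<one>\<^bsub>incidence\<^esub>"
    using incidence_right_inverse[OF b(1)] b(3) diag by auto
  have "a = a \<otimes>\<^bsub>incidence\<^esub> (b \<otimes>\<^bsub>incidence\<^esub> c)" using a c(2) by simp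
  also have "\<dots> = c" using a b c(1) by (simp flip: m_assoc)
  finally have "b \<otimes>\<^bsub>incidence\<^esub> a = \<one>\<^bsub>incidence\<^esub>" using c(2) by simp
  then show ?thesis using a b(1,2) unfolding Units_def by blast
qed

text \<open>The equation \<open>(x - 1) \<zeta> \<chi>bar = Z - x \<zeta>\<close> with \<open>Z s t = x^(rk t - rk s)\<close> turns
  \<open>\<chi>bar H = - 1\<close> into a recursion for \<open>H\<close> without Moebius functions.\<close>

theorem chow_function_rec:
  assumes s: "s \<in> P" and t: "t \<in> P" and st: "s \<le> t"
  shows "chow_function P rk s t =
    1 + (\<Sum>w\<in>{w \<in> P. s < w \<and> w \<le> t}. chow_gap (rk w - rk s) * chow_function P rk w t)"
proof -
  interpret Group.monoid incidence by (rule incidence_monoid)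
  let ?z = "zeta_function P" and ?m = "moebius_function P" and ?c = "char_function P rk"
  let ?r = "reduced_char_function P rk" and ?H = "chow_function P rk"
  define Z :: "'a \<Rightarrow> 'a \<Rightarrow> int poly"
    where "Z = (\<lambda>s t. if s \<in> P \<and> t \<in> P \<and> s \<le> t then monom 1 (rk t - rk s) else 0)"
  have z_in: "?z \<in> carrier incidence" and Z_in: "Z \<in> carrier incidence"
    and c_in: "?c \<in> carrier incidence" and r_in: "?r \<in> carrier incidence"
    by (auto simp: incidence_carrier zeta_function_def Z_def char_function_def reduced_char_function_def)
  have zU: "?z \<in> Units incidence" by (rule incidence_Units[OF z_in]) (simp add: zeta_function_def)
  have rU: "?r \<in> Units incidence" by (rule incidence_Units[OF r_in]) (simp add: reduced_char_function_def)
  have m_in: "?m \<in> carrier incidence" and mz: "?m \<otimes>\<^bsub>incidence\<^esub> ?z = \<one>\<^bsub>incidence\<^esub>"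
    and zm: "?z \<otimes>\<^bsub>incidence\<^esub> ?m = \<one>\<^bsub>incidence\<^esub>"
    unfolding moebius_function_def using zU by auto
  have c_eq: "?c = ?m \<otimes>\<^bsub>incidence\<^esub> Z"
  proof (intro ext)
    fix s t
    show "?c s t = (?m \<otimes>\<^bsub>incidence\<^esub> Z) s t"
    proof (cases "s \<in> P \<and> t \<in> P \<and> s \<le> t")
      case True
      then show ?thesis unfolding incidence_mult_def
        by (auto simp: char_function_def Z_def intro!: sum.cong)
    next
      case False
      then show ?thesis using c_in incidence_mult_closed[OF m_in Z_in] by (simp add: incidence_carrier)
    qed
  qed
  have zc: "?z \<otimes>\<^bsub>incidence\<^esub> ?c = Z"
    unfolding c_eq using z_in m_in Z_in zm by (simp flip: m_assoc)
  have x1_r: "[:-1, 1:] * ?r v w = ?c v w - [:0, 1:] * \<one>\<^bsub>incidence\<^esub> v w" for v w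
  proof (cases "v \<in> P \<and> w \<in> P \<and> v \<le> w")
    case False
    then show ?thesis using r_in c_in by (auto simp: incidence_carrier incidence_one)
  next
    case True
    show ?thesis
    proof (cases "v = w")
      case True
      then have "{u \<in> P. v \<le> u \<and> u \<le> w} = {v}" using \<open>v \<in> P \<and> w \<in> P \<and> v \<le> w\<close> by auto
      moreover from this have "?m v v * ?z v v = 1"
        using fun_cong[OF fun_cong[OF mz, of v], of v] True \<open>v \<in> P \<and> w \<in> P \<and> v \<le> w\<close>
        unfolding incidence_mult_def incidence_one by simp
      ultimately show ?thesis
        using True \<open>v \<in> P \<and> w \<in> P \<and> v \<le> w\<close>
        by (simp add: reduced_char_function_def char_function_def incidence_one zeta_function_def one_pCons)
    next
      case False
      \<comment> \<open>At \<open>x = 1\<close> the characteristic function becomes the product of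
        \<mu> and \<zeta>, which is zero off the diagonal. Hence the division is exact.\<close>
      have "poly (?c v w) 1 = poly ((?m \<otimes>\<^bsub>incidence\<^esub> ?z) v w) 1"
        unfolding incidence_mult_def using True
        by (auto simp: char_function_def zeta_function_def poly_sum poly_monom intro!: sum.cong)
      also have "\<dots> = 0" unfolding mz incidence_one using False by simp
      finally have "[:-1, 1:] dvd ?c v w" by (simp add: poly_eq_0_iff_dvd)
      then have "[:-1, 1:] * (?c v w div [:-1, 1:]) = ?c v w" by (rule dvd_mult_div_cancel)
      moreover have "?r v w = ?c v w div [:-1, 1:]" "\<one>\<^bsub>incidence\<^esub> v w = 0"
        using True False by (auto simp: reduced_char_function_def incidence_one less_le)
      ultimately show ?thesis by (simp only: mult_zero_right diff_zero)
    qed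
  qed
  have zr: "[:-1, 1:] * (?z \<otimes>\<^bsub>incidence\<^esub> ?r) v w = Z v w - [:0, 1:] * ?z v w" for v w
  proof -
    have "[:-1, 1:] * (?z \<otimes>\<^bsub>incidence\<^esub> ?r) v w = (\<Sum>u\<in>P. ?z v u * ([:-1, 1:] * ?r u w))"
      unfolding incidence_mult[OF z_in r_in] sum_distrib_left by (simp only: mult.left_commute)
    also have "\<dots> = (\<Sum>u\<in>P. ?z v u * ?c u w) - [:0, 1:] * (\<Sum>u\<in>P. ?z v u * \<one>\<^bsub>incidence\<^esub> u w)"
      unfolding x1_r right_diff_distrib sum_subtractf sum_distrib_left by (simp only: mult.left_commute)
    also have "\<dots> = (?z \<otimes>\<^bsub>incidence\<^esub> ?c) v w - [:0, 1:] * (?z \<otimes>\<^bsub>incidence\<^esub> \<one>\<^bsub>incidence\<^esub>) v w"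
      unfolding incidence_mult[OF z_in c_in] incidence_mult[OF z_in one_closed] ..
    finally show ?thesis unfolding zc using z_in by simp
  qed
  have ri_in: "inv\<^bsub>incidence\<^esub> ?r \<in> carrier incidence" using rU by simp
  have H_eq: "?H v w = - (inv\<^bsub>incidence\<^esub> ?r) v w" for v w
    unfolding chow_function_def incidence_a_inv[OF ri_in] ..
  have H_in: "?H \<in> carrier incidence" using ri_in by (auto simp: incidence_carrier H_eq)
  have zrH: "(\<Sum>w\<in>P. (?z \<otimes>\<^bsub>incidence\<^esub> ?r) s w * ?H w t) = - ?z s t"
  proof -
    have "(\<Sum>w\<in>P. (?z \<otimes>\<^bsub>incidence\<^esub> ?r) s w * ?H w t) =
        - (?z \<otimes>\<^bsub>incidence\<^esub> ?r \<otimes>\<^bsub>incidence\<^esub> inv\<^bsub>incidence\<^esub> ?r) s t"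
      unfolding H_eq incidence_mult[OF incidence_mult_closed[OF z_in r_in] ri_in] by (simp add: sum_negf)
    also have "?z \<otimes>\<^bsub>incidence\<^esub> ?r \<otimes>\<^bsub>incidence\<^esub> inv\<^bsub>incidence\<^esub> ?r = ?z"
      using z_in r_in ri_in rU by (simp add: m_assoc)
    finally show ?thesis .
  qed
  have "[:-1, 1:] * (- ?z s t) = (\<Sum>w\<in>P. (Z s w - [:0, 1:] * ?z s w) * ?H w t)"
    unfolding zrH[symmetric] sum_distrib_left mult.assoc[symmetric] zr ..
  also have "\<dots> = (\<Sum>w\<in>{w \<in> P. s \<le> w \<and> w \<le> t}. (Z s w - [:0, 1:] * ?z s w) * ?H w t)"
    by (rule sum.mono_neutral_right)
      (use finite_carrier H_in in \<open>auto simp: incidence_carrier Z_def zeta_function_def\<close>)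
  also have "{w \<in> P. s \<le> w \<and> w \<le> t} = insert s {w \<in> P. s < w \<and> w \<le> t}"
    using assms by (auto simp: le_less)
  also have "(\<Sum>w\<in>insert s {w \<in> P. s < w \<and> w \<le> t}. (Z s w - [:0, 1:] * ?z s w) * ?H w t) =
      (Z s s - [:0, 1:] * ?z s s) * ?H s t +
      (\<Sum>w\<in>{w \<in> P. s < w \<and> w \<le> t}. (Z s w - [:0, 1:] * ?z s w) * ?H w t)"
    using finite_carrier by simp
  also have "Z s s - [:0, 1:] * ?z s s = - [:-1, 1:]"
    using s by (simp add: Z_def zeta_function_def monom_0 one_pCons)
  also have "(\<Sum>w\<in>{w \<in> P. s < w \<and> w \<le> t}. (Z s w - [:0, 1:] * ?z s w) * ?H w t) =
      (\<Sum>w\<in>{w \<in> P. s < w \<and> w \<le> t}. [:-1, 1:] * (chow_gap (rk w - rk s) * ?H w t))"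
  proof (rule sum.cong[OF refl])
    fix w assume "w \<in> {w \<in> P. s < w \<and> w \<le> t}"
    then have w: "w \<in> P" "s < w" by auto
    then have "Z s w - [:0, 1:] * ?z s w = monom 1 (rk w - rk s) - [:0, 1:]"
      using s w(1) less_imp_le[OF w(2)]
      by (simp only: Z_def zeta_function_def simp_thms if_True mult_1_right)
    also have "\<dots> = [:-1, 1:] * chow_gap (rk w - rk s)"
      using rk_strict_mono[OF s w] by (intro chow_gap_mult[symmetric]) simp
    finally show "(Z s w - [:0, 1:] * ?z s w) * ?H w t = [:-1, 1:] * (chow_gap (rk w - rk s) * ?H w t)"
      by (simp only: mult.assoc)
  qed
  finally have "[:-1, 1:] * (- ?z s t) = [:-1, 1:] *
      ((\<Sum>w\<in>{w \<in> P. s < w \<and> w \<le> t}. chow_gap (rk w - rk s) * ?H w t) - ?H s t)"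
    unfolding sum_distrib_left[symmetric] by (simp only: algebra_simps)
  then have "- ?z s t = (\<Sum>w\<in>{w \<in> P. s < w \<and> w \<le> t}. chow_gap (rk w - rk s) * ?H w t) - ?H s t"
    by (subst (asm) mult_cancel_left) simp
  moreover have "?z s t = 1" using assms by (simp add: zeta_function_def)
  ultimately show ?thesis by (simp add: algebra_simps)
qed

end

section \<open>Weights of rank sets\<close>

text \<open>The product over the gaps between consecutive ranks, for the rank set \<open>S\<close> of a chain above
  an element of rank \<open>i\<close>.\<close>

definition chow_weight :: "nat \<Rightarrow> nat set \<Rightarrow> int poly" where
  "chow_weight i S = (\<Prod>s\<in>S. chow_gap (s - Max (insert i {x \<in> S. x < s})))"

lemma chow_weight_empty [simp]: "chow_weight i {} = 1"
  by (simp add: chow_weight_def)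

text \<open>Splitting off the least rank matches \<open>chow_function_rec\<close>, with
  \<open>j\<close> replacing \<open>i\<close> as the base.\<close>

lemma chow_weight_insert_least:
  assumes "finite S" "i < j" "\<And>x. x \<in> S \<Longrightarrow> j < x"
  shows "chow_weight i (insert j S) = chow_gap (j - i) * chow_weight j S"
proof -
  have "j \<notin> S" using assms(3) by blast
  with assms(1) have "chow_weight i (insert j S) =
      chow_gap (j - Max (insert i {x \<in> insert j S. x < j})) *
      (\<Prod>s\<in>S. chow_gap (s - Max (insert i {x \<in> insert j S. x < s})))"
    unfolding chow_weight_def by (rule prod.insert)
  moreover have "{x \<in> insert j S. x < j} = {}" using assms(3) by fastforce
  moreover have "(\<Prod>s\<in>S. chow_gap (s - Max (insert i {x \<in> insert j S. x < s}))) = chow_weight j S"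
    unfolding chow_weight_def
  proof (rule prod.cong[OF refl])
    fix s assume "s \<in> S"
    then have "{x \<in> insert j S. x < s} = insert j {x \<in> S. x < s}" using assms(3) by auto
    moreover have "Max (insert i (insert j {x \<in> S. x < s})) = Max (insert j {x \<in> S. x < s})"
      using assms(1,2) by (subst Max_insert) (auto simp: max_def not_le le_less_trans intro: less_imp_le)
    ultimately show "chow_gap (s - Max (insert i {x \<in> insert j S. x < s})) =
        chow_gap (s - Max (insert j {x \<in> S. x < s}))" by simp
  qed
  ultimately show ?thesis by (simp only: Max_singleton)
qed

text \<open>The recursion for the weight sums adds ranks at the top instead.\<close>

lemma chow_weight_insert_greatest:
  assumes "finite S" "\<And>x. x \<in> S \<Longrightarrow> x < n"
  shows "chow_weight i (insert n S) = chow_gap (n - Max (insert i S)) * chow_weight i S"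
proof -
  have "n \<notin> S" using assms(2) by blast
  moreover have "{x \<in> insert n S. x < n} = S" using assms(2) by auto
  moreover have "(\<Prod>s\<in>S. chow_gap (s - Max (insert i {x \<in> insert n S. x < s}))) = chow_weight i S"
    unfolding chow_weight_def
  proof (rule prod.cong[OF refl])
    fix s assume "s \<in> S"
    then have "{x \<in> insert n S. x < s} = {x \<in> S. x < s}" using assms(2) by fastforce
    then show "chow_gap (s - Max (insert i {x \<in> insert n S. x < s})) =
        chow_gap (s - Max (insert i {x \<in> S. x < s}))" by simp
  qed
  ultimately show ?thesis using assms(1) by (simp add: chow_weight_def)
qed

section \<open>Sums of weights over the supersets of a rank set\<close>

definition supersets_upto :: "nat set \<Rightarrow> nat \<Rightarrow> nat set set" where
  "supersets_upto T n = {S. T \<inter> {1..n} \<subseteq> S \<and> S \<subseteq> {1..n}}"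

text \<open>For \<open>n\<close> the rank of the poset this is \<open>V\<^sub>T\<close>; smaller
  \<open>n\<close> serve the recursion.\<close>

definition weight_sum :: "nat set \<Rightarrow> nat \<Rightarrow> int poly" where
  "weight_sum T n = (\<Sum>S\<in>supersets_upto T n. chow_weight 0 S)"

definition weight_sum_ending :: "nat set \<Rightarrow> nat \<Rightarrow> int poly" where
  "weight_sum_ending T n = (\<Sum>S\<in>supersets_upto T n. chow_weight 0 (insert (Suc n) S))"

lemma finite_supersets_upto [simp]: "finite (supersets_upto T n)"
  by (rule finite_subset[of _ "Pow {1..n}"]) (auto simp: supersets_upto_def)

lemma supersets_upto_0: "supersets_upto T 0 = {{}}"
  by (auto simp: supersets_upto_def)

lemma sum_supersets_upto_Suc:
  fixes g :: "nat set \<Rightarrow> 'b::comm_monoid_add"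
  shows "(\<Sum>S\<in>supersets_upto T (Suc n). g S) =
    (if Suc n \<in> T then 0 else \<Sum>S\<in>supersets_upto T n. g S) +
    (\<Sum>S\<in>supersets_upto T n. g (insert (Suc n) S))"
proof -
  have notin: "Suc n \<notin> S" if "S \<in> supersets_upto T n" for S
    using that by (auto simp: supersets_upto_def)
  have atL: "{1..Suc n} = insert (Suc n) {1..n}" by auto
  have eq: "supersets_upto T (Suc n) =
      (if Suc n \<in> T then {} else supersets_upto T n) \<union> insert (Suc n) ` supersets_upto T n"
    (is "?L = ?R")
  proof (intro equalityI subsetI)
    fix S assume S: "S \<in> ?L"
    show "S \<in> ?R"
    proof (cases "Suc n \<in> S")
      case True
      then have "S = insert (Suc n) (S - {Suc n})" by auto
      moreover have "S - {Suc n} \<in> supersets_upto T n"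
        using S unfolding supersets_upto_def atL by auto
      ultimately show ?thesis by blast
    next
      case False
      then have "Suc n \<notin> T" "S \<in> supersets_upto T n"
        using S unfolding supersets_upto_def atL by auto
      then show ?thesis by simp
    qed
  next
    fix S assume "S \<in> ?R"
    then show "S \<in> ?L" unfolding supersets_upto_def atL by (auto split: if_splits)
  qed
  have inj: "inj_on (insert (Suc n)) (supersets_upto T n)"
    by (rule inj_onI) (metis insert_ident notin)
  have "(\<Sum>S\<in>?R. g S) = (\<Sum>S\<in>(if Suc n \<in> T then {} else supersets_upto T n). g S) +
      (\<Sum>S\<in>insert (Suc n) ` supersets_upto T n. g S)"
    by (rule sum.union_disjoint) (use notin in auto)
  then show ?thesis unfolding eq by (simp add: sum.reindex[OF inj])
qed

lemma weight_sum_Suc: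
  "weight_sum T (Suc n) = (if Suc n \<in> T then 0 else weight_sum T n) + weight_sum_ending T n"
  unfolding weight_sum_def weight_sum_ending_def by (rule sum_supersets_upto_Suc)

text \<open>A gap of length one has weight zero, so nothing remains if \<open>n\<close> is 0 or
  forced by \<open>T\<close>. Otherwise only sets \<open>S\<close> without \<open>n\<close>
  contribute. Since lengthening a gap by one means multiplying by \<open>x\<close> and adding
  \<open>x\<close>, the weight with top \<open>n + 1\<close> is \<open>x\<close> times the sum of
  the weights of \<open>S\<close> and \<open>insert n S\<close>.\<close>

lemma weight_sum_ending_eq:
  "weight_sum_ending T n = (if n \<in> insert 0 T then 0 else [:0, 1:] * weight_sum T n)"
proof (cases n)
  case 0
  then show ?thesis
    using chow_weight_insert_greatest[of "{}" "Suc 0" 0]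
    by (simp add: weight_sum_ending_def supersets_upto_0)
next
  case (Suc m)
  have S: "finite S" "\<And>x. x \<in> S \<Longrightarrow> x \<le> m" if "S \<in> supersets_upto T m" for S
    using that finite_subset[of S "{1..m}"] by (auto simp: supersets_upto_def)
  have zero: "chow_weight 0 (insert (Suc (Suc m)) (insert (Suc m) S)) = 0" if "S \<in> supersets_upto T m" for S
  proof -
    have "Max (insert 0 (insert (Suc m) S)) = Suc m"
      using S[OF that] by (intro Max_eqI) (auto simp: le_Suc_eq)
    then show ?thesis
      using S[OF that] by (subst chow_weight_insert_greatest) (auto simp: less_Suc_eq_le le_Suc_eq)
  qed
  have step: "chow_weight 0 (insert (Suc (Suc m)) S) =
      [:0, 1:] * (chow_weight 0 S + chow_weight 0 (insert (Suc m) S))" if "S \<in> supersets_upto T m" for S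
  proof -
    have le: "Max (insert 0 S) \<le> m" using S[OF that] by simp
    have "chow_gap (Suc (Suc m) - Max (insert 0 S)) =
        [:0, 1:] * chow_gap (Suc m - Max (insert 0 S)) + [:0, 1:]"
      using le by (simp add: Suc_diff_le)
    moreover have "chow_weight 0 (insert (Suc (Suc m)) S) =
        chow_gap (Suc (Suc m) - Max (insert 0 S)) * chow_weight 0 S"
      using S[OF that] by (intro chow_weight_insert_greatest) (auto simp: less_Suc_eq_le le_Suc_eq)
    moreover have "chow_weight 0 (insert (Suc m) S) = chow_gap (Suc m - Max (insert 0 S)) * chow_weight 0 S"
      using S[OF that] by (intro chow_weight_insert_greatest) (auto simp: less_Suc_eq_le)
    ultimately show ?thesis by (simp only: algebra_simps)
  qed
  have "weight_sum_ending T (Suc m) = (if Suc m \<in> T then 0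
      else [:0, 1:] * (weight_sum T m + weight_sum_ending T m))"
    unfolding weight_sum_ending_def sum_supersets_upto_Suc weight_sum_def
    by (simp add: zero step sum.distrib flip: sum_distrib_left del: mult_pCons_left)
  then show ?thesis using weight_sum_Suc[of T m] Suc by simp
qed

text \<open>The step from \<open>n\<close> to \<open>n + 1\<close> multiplies by 0, 1,
  \<open>x\<close> or \<open>1 + x\<close>, depending on whether \<open>n\<close> is in
  \<open>insert 0 T\<close> and \<open>n + 1\<close> in \<open>T\<close>. A step into
  \<open>T\<close> gives \<open>x\<close> and the next one gives 1, so each element of
  \<open>T\<close> uses up two steps; the first step of all, if not into \<open>T\<close>, also
  gives 1. The two cases tell whether such a step with factor 1 is still due. The factor 0 belongs
  to rank 1 and to consecutive ranks in \<open>T\<close>.\<close>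

lemma weight_sum_closed_form:
  fixes T :: "nat set" and n :: nat
  defines "t \<equiv> card (T \<inter> {1..n})"
  shows "weight_sum T n = 0 \<or>
    (if n \<in> insert 0 T then 2 * t \<le> n \<and> weight_sum T n = [:0, 1:] ^ t * [:1, 1:] ^ (n - 2 * t)
     else 2 * t < n \<and> weight_sum T n = [:0, 1:] ^ t * [:1, 1:] ^ (n - 1 - 2 * t))"
  unfolding t_def
proof (induction n)
  case 0
  then show ?case by (simp add: weight_sum_def supersets_upto_0)
next
  case (Suc n)
  define c where "c = card (T \<inter> {1..n})"
  have rec: "weight_sum T (Suc n) = (if Suc n \<in> T then 0 else weight_sum T n) +
      (if n \<in> insert 0 T then 0 else [:0, 1:] * weight_sum T n)"
    using weight_sum_Suc weight_sum_ending_eq by simp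
  have at: "{1..Suc n} = insert (Suc n) {1..n}" by auto
  have card: "card (T \<inter> {1..Suc n}) = (if Suc n \<in> T then Suc c else c)"
    unfolding at c_def by auto
  note IH = Suc.IH[folded c_def]
  show ?case
  proof (cases "weight_sum T n = 0")
    case True
    then show ?thesis using rec by simp
  next
    case nz: False
    show ?thesis
    proof (cases "n \<in> insert 0 T")
      case True
      then show ?thesis using IH nz rec card by (auto simp: Suc_diff_le)
    next
      case False
      then have c: "2 * c < n" and w: "weight_sum T n = [:0, 1:] ^ c * [:1, 1:] ^ (n - 1 - 2 * c)"
        using IH nz by auto
      show ?thesis
      proof (cases "Suc n \<in> T")
        case True
        then have "weight_sum T (Suc n) = [:0, 1:] ^ Suc c * [:1, 1:] ^ (Suc n - 2 * Suc c)"
          using rec False w by (simp add: mult.assoc)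
        then show ?thesis using True card c by simp
      next
        case nT: False
        have "weight_sum T (Suc n) = [:1, 1:] * weight_sum T n"
          using rec False nT by simp
        also have "\<dots> = [:0, 1:] ^ c * ([:1, 1:] * [:1, 1:] ^ (n - 1 - 2 * c))"
          unfolding w by (simp only: mult.left_commute)
        also have "[:1, 1:] * [:1, 1:] ^ (n - 1 - 2 * c) = [:1, 1:] ^ (Suc n - 1 - 2 * c)"
          using c by (simp flip: power_Suc add: Suc_diff_Suc)
        finally show ?thesis using nT card c by simp
      qed
    qed
  qed
qed

section \<open>The flag vectors and the Chow polynomial\<close>

lemma smult_sum_right: "smult c (\<Sum>i\<in>I. f i) = (\<Sum>i\<in>I. smult c (f i))"
  by (induction I rule: infinite_finite_induct) (auto simp: smult_add_right)

context finite_graded_bounded_poset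
begin

text \<open>The recursion unfolds with \<open>w\<close> as the least element of a nonempty chain;
  the summand 1 is the weight of the empty chain.\<close>

theorem chow_function_chains:
  assumes "s \<in> P" "t \<in> P" "s \<le> t"
  shows "chow_function P rk s t =
    (\<Sum>C | C \<subseteq> {w \<in> P. s < w \<and> w \<le> t} \<and> order_chain C. chow_weight (rk s) (rk ` C))"
  using assms
proof (induction "card {w \<in> P. s < w \<and> w \<le> t}" arbitrary: s rule: less_induct)
  case less
  note st = less.prems
  define \<C> where "\<C> = (\<lambda>s. {C. C \<subseteq> {w \<in> P. s < w \<and> w \<le> t} \<and> order_chain C})"
  define V where "V = {w \<in> P. s < w \<and> w \<le> t}"
  have finV: "finite V" using finite_carrier by (simp add: V_def)
  have fin\<C>: "finite (\<C> u)" for u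
    by (rule finite_subset[of _ "Pow P"]) (use finite_carrier in \<open>auto simp: \<C>_def\<close>)
  have finC: "finite C" if "C \<in> \<C> u" for C u
    by (rule finite_subset[OF _ finite_carrier]) (use that in \<open>auto simp: \<C>_def\<close>)
  have above: "u < x" if "C \<in> \<C> u" "x \<in> C" for C u x
    using that by (auto simp: \<C>_def)
  have inj: "inj_on (\<lambda>(w, C). insert w C) (Sigma V \<C>)"
  proof (rule inj_onI, clarify)
    fix w C w' C'
    assume C: "C \<in> \<C> w" "C' \<in> \<C> w'" and eq: "insert w C = insert w' C'"
    have "w = w'"
    proof (rule ccontr)
      assume "w \<noteq> w'"
      then have "w' \<in> C" "w \<in> C'" using eq by auto
      then show False using above[OF C(1)] above[OF C(2)] less_asym by blast
    qed
    moreover have "w \<notin> C" "w' \<notin> C'" using above[OF C(1)] above[OF C(2)] by blast+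
    ultimately show "w = w' \<and> C = C'" using eq by auto
  qed
  have image: "(\<lambda>(w, C). insert w C) ` Sigma V \<C> = \<C> s - {{}}"
  proof (intro equalityI subsetI)
    fix D assume "D \<in> (\<lambda>(w, C). insert w C) ` Sigma V \<C>"
    then obtain w C where D: "D = insert w C" "w \<in> V" "C \<in> \<C> w" by auto
    have "order_chain (insert w C)"
      by (rule order_chain_insert) (use D(3) in \<open>auto simp: \<C>_def less_imp_le\<close>)
    moreover have "s < x" if "x \<in> C" for x
      using above[OF D(3) that] D(2) by (auto simp: V_def)
    ultimately show "D \<in> \<C> s - {{}}" using D by (auto simp: \<C>_def V_def)
  next
    fix D assume D: "D \<in> \<C> s - {{}}"
    then obtain m where m: "m \<in> D" "\<And>x. x \<in> D \<Longrightarrow> \<not> x < m"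
      using finite_has_minimal[OF finC, of D s] by (metis DiffD1 DiffD2 insertI1 less_le)
    have chain: "order_chain D" and sub: "D \<subseteq> V" using D by (auto simp: \<C>_def V_def)
    have "m < x" if "x \<in> D - {m}" for x
      using that m chain by (auto simp: Complete_Partial_Order.chain_def less_le)
    then have "D - {m} \<in> \<C> m"
      using sub order_chain_subset[OF chain, of "D - {m}"] by (auto simp: \<C>_def V_def)
    moreover have "m \<in> V" using m(1) sub by auto
    moreover have "D = insert m (D - {m})" using m(1) by auto
    ultimately show "D \<in> (\<lambda>(w, C). insert w C) ` Sigma V \<C>" by blast
  qed
  have "chow_function P rk s t = 1 + (\<Sum>w\<in>V. chow_gap (rk w - rk s) * chow_function P rk w t)"
    unfolding V_def using st by (rule chow_function_rec)
  also have "(\<Sum>w\<in>V. chow_gap (rk w - rk s) * chow_function P rk w t) =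
      (\<Sum>w\<in>V. \<Sum>C\<in>\<C> w. chow_weight (rk s) (rk ` insert w C))"
  proof (rule sum.cong[OF refl])
    fix w assume "w \<in> V"
    then have w: "w \<in> P" "s < w" "w \<le> t" by (auto simp: V_def)
    have "{v \<in> P. w < v \<and> v \<le> t} \<subset> {v \<in> P. s < v \<and> v \<le> t}"
    proof
      show "{v \<in> P. w < v \<and> v \<le> t} \<subseteq> {v \<in> P. s < v \<and> v \<le> t}"
        using less_trans[OF w(2)] by blast
      show "{v \<in> P. w < v \<and> v \<le> t} \<noteq> {v \<in> P. s < v \<and> v \<le> t}" using w by blast
    qed
    then have "card {v \<in> P. w < v \<and> v \<le> t} < card {v \<in> P. s < v \<and> v \<le> t}"
      using finite_carrier by (intro psubset_card_mono) auto
    then have "chow_function P rk w t = (\<Sum>C\<in>\<C> w. chow_weight (rk w) (rk ` C))"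
      unfolding \<C>_def by (rule less.hyps[OF _ w(1) st(2) w(3)])
    moreover have "chow_weight (rk s) (rk ` insert w C) = chow_gap (rk w - rk s) * chow_weight (rk w) (rk ` C)"
      if C: "C \<in> \<C> w" for C
    proof -
      have "rk w < rk x" if "x \<in> C" for x
        by (rule rk_strict_mono) (use w C that in \<open>auto simp: \<C>_def\<close>)
      then show ?thesis
        using rk_strict_mono[OF st(1) w(1,2)] finC[OF C]
        by (simp, intro chow_weight_insert_least) auto
    qed
    ultimately show "chow_gap (rk w - rk s) * chow_function P rk w t =
        (\<Sum>C\<in>\<C> w. chow_weight (rk s) (rk ` insert w C))"
      by (simp add: sum_distrib_left)
  qed
  also have "\<dots> = (\<Sum>(w, C)\<in>Sigma V \<C>. chow_weight (rk s) (rk ` insert w C))"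
    using finV fin\<C> by (intro sum.Sigma) auto
  also have "\<dots> = (\<Sum>D\<in>\<C> s - {{}}. chow_weight (rk s) (rk ` D))"
    unfolding image[symmetric] sum.reindex[OF inj] by (rule sum.cong) auto
  also have "1 + \<dots> = (\<Sum>D\<in>\<C> s. chow_weight (rk s) (rk ` D))"
    using fin\<C> by (subst sum.remove[of "\<C> s" "{}"]) (auto simp: \<C>_def Complete_Partial_Order.chain_empty)
  finally show ?case unfolding \<C>_def .
qed

section \<open>Flag f-vector and flag h-vector\<close>

definition proper_chains :: "'a set set" where
  "proper_chains = {C. C \<subseteq> {w \<in> P. bt < w \<and> w < tp} \<and> order_chain C}"

definition flag_f :: "nat set \<Rightarrow> int" where
  "flag_f S = int (card {C \<in> proper_chains. rk ` C = S})"

text \<open>The usual sign \<open>(-1) ^ card (S - T)\<close> is split, so that the inner sum is a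
  signed count of chains.\<close>

definition flag_h :: "nat set \<Rightarrow> int" where
  "flag_h S = (-1) ^ card S * (\<Sum>T\<in>Pow S. (-1) ^ card T * flag_f T)"

lemma finite_proper_chains: "finite proper_chains"
  by (rule finite_subset[of _ "Pow P"]) (use finite_carrier in \<open>auto simp: proper_chains_def\<close>)

lemma flag_f_eq_sum_flag_h: "finite S \<Longrightarrow> flag_f S = (\<Sum>T\<in>Pow S. flag_h T)"
  using inclusion_exclusion_symmetric[of "\<lambda>S. \<Sum>T\<in>Pow S. (-1) ^ card T * flag_f T" flag_f S]
  by (simp add: flag_h_def)

lemma rk_proper: "w \<in> P \<Longrightarrow> bt < w \<Longrightarrow> w < tp \<Longrightarrow> rk w \<in> {1..rk tp - 1}"
  using rk_strict_mono[of bt w] rk_strict_mono[of w tp] bt_in tp_in rk_bt by auto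

text \<open>Chains in the half-open interval come in pairs, a proper chain and the same chain with
  \<open>tp\<close> added; hence two weights for each rank set.\<close>

lemma chow_function_flag_f:
  assumes r: "1 \<le> rk tp"
  shows "chow_function P rk bt tp = (\<Sum>S\<in>Pow {1..rk tp - 1}.
    smult (flag_f S) (chow_weight 0 S + chow_weight 0 (insert (rk tp) S)))"
proof -
  have bttp: "bt < tp" using r rk_bt bt_le[OF tp_in] by (auto simp: le_less)
  have notin: "tp \<notin> C" if "C \<in> proper_chains" for C using that by (auto simp: proper_chains_def)
  have inj: "inj_on (insert tp) proper_chains"
    by (rule inj_onI) (metis insert_ident notin)
  have eq: "{C. C \<subseteq> {w \<in> P. bt < w \<and> w \<le> tp} \<and> order_chain C} =
      proper_chains \<union> insert tp ` proper_chains" (is "?L = ?R")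
  proof (intro equalityI subsetI)
    fix C assume C: "C \<in> ?L"
    have "C - {tp} \<in> proper_chains"
      using C order_chain_subset[of C "C - {tp}"] by (auto simp: proper_chains_def less_le)
    moreover have "C = C - {tp} \<or> C = insert tp (C - {tp})" by blast
    ultimately show "C \<in> ?R" by (metis UnI1 UnI2 imageI)
  next
    fix C assume "C \<in> ?R"
    then consider "C \<in> proper_chains" | D where "D \<in> proper_chains" "C = insert tp D" by blast
    then show "C \<in> ?L"
    proof cases
      case 1
      then show ?thesis by (auto simp: proper_chains_def)
    next
      case 2
      then have "order_chain (insert tp D)"
        by (intro order_chain_insert) (auto simp: proper_chains_def less_imp_le)
      then show ?thesis using 2 bttp tp_in by (auto simp: proper_chains_def)
    qed
  qed
  have "chow_function P rk bt tp = (\<Sum>C\<in>?R. chow_weight 0 (rk ` C))"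
    using chow_function_chains[OF bt_in tp_in bt_le[OF tp_in]] unfolding eq rk_bt .
  also have "\<dots> = (\<Sum>C\<in>proper_chains. chow_weight 0 (rk ` C)) +
      (\<Sum>C\<in>insert tp ` proper_chains. chow_weight 0 (rk ` C))"
    using finite_proper_chains notin by (intro sum.union_disjoint) auto
  also have "\<dots> = (\<Sum>C\<in>proper_chains. chow_weight 0 (rk ` C) + chow_weight 0 (insert (rk tp) (rk ` C)))"
    by (simp add: sum.reindex[OF inj] sum.distrib)
  also have "\<dots> = (\<Sum>S\<in>Pow {1..rk tp - 1}. \<Sum>C\<in>{C \<in> proper_chains. rk ` C = S}.
      chow_weight 0 (rk ` C) + chow_weight 0 (insert (rk tp) (rk ` C)))"
  proof (rule sum.group[symmetric])
    show "(\<lambda>C. rk ` C) ` proper_chains \<subseteq> Pow {1..rk tp - 1}"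
      using rk_proper unfolding proper_chains_def by blast
  qed (use finite_proper_chains in auto)
  also have "\<dots> = (\<Sum>S\<in>Pow {1..rk tp - 1}.
      smult (flag_f S) (chow_weight 0 S + chow_weight 0 (insert (rk tp) S)))"
    by (rule sum.cong[OF refl]) (simp add: flag_f_def of_nat_poly flip: smult_add_right)
  finally show ?thesis .
qed

text \<open>Exchanging the sums collects the weights over the supersets of \<open>T\<close>. As
  \<open>rk tp\<close> is not in \<open>T\<close>, those with and without \<open>rk tp\<close>
  combine to one weight sum.\<close>

lemma chow_function_flag_h:
  assumes r: "1 \<le> rk tp"
  shows "chow_function P rk bt tp = (\<Sum>T\<in>Pow {1..rk tp - 1}. smult (flag_h T) (weight_sum T (rk tp)))"
proof -
  define n where "n = rk tp - 1"
  have n: "rk tp = Suc n" using r by (simp add: n_def)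
  let ?w = "\<lambda>S. chow_weight 0 S + chow_weight 0 (insert (Suc n) S)"
  have "chow_function P rk bt tp = (\<Sum>S\<in>Pow {1..n}. smult (flag_f S) (?w S))"
    using chow_function_flag_f[OF r] by (simp add: n)
  also have "\<dots> = (\<Sum>S\<in>Pow {1..n}. \<Sum>T\<in>Pow S. smult (flag_h T) (?w S))"
    by (rule sum.cong[OF refl]) (simp add: flag_f_eq_sum_flag_h finite_subset[of _ "{1..n}"] smult_sum)
  also have "\<dots> = (\<Sum>S\<in>Pow {1..n}. \<Sum>T\<in>{T \<in> Pow {1..n}. T \<subseteq> S}. smult (flag_h T) (?w S))"
    by (intro sum.cong) auto
  also have "\<dots> = (\<Sum>T\<in>Pow {1..n}. \<Sum>S\<in>{S \<in> Pow {1..n}. T \<subseteq> S}. smult (flag_h T) (?w S))"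
    by (rule sum.swap_restrict) auto
  also have "\<dots> = (\<Sum>T\<in>Pow {1..n}. smult (flag_h T) (weight_sum T (rk tp)))"
  proof (rule sum.cong[OF refl])
    fix T assume T: "T \<in> Pow {1..n}"
    then have "T \<inter> {1..n} = T" "Suc n \<notin> T" by auto
    moreover from this have "{S \<in> Pow {1..n}. T \<subseteq> S} = supersets_upto T n"
      by (auto simp: supersets_upto_def)
    ultimately show "(\<Sum>S\<in>{S \<in> Pow {1..n}. T \<subseteq> S}. smult (flag_h T) (?w S)) =
        smult (flag_h T) (weight_sum T (rk tp))"
      unfolding n weight_sum_Suc
      by (simp add: weight_sum_def weight_sum_ending_def sum.distrib smult_sum_right smult_add_right)
  qed
  finally show ?thesis unfolding n by simp
qed

text \<open>Grouping the chains of the rank selection by their rank sets turns their signed count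
  into the sum that defines \<open>flag_h T\<close>.\<close>

lemma flag_h_nonneg:
  assumes cm: "cohen_macaulay P rk" and T: "T \<subseteq> {1..rk tp - 1}" and r: "1 \<le> rk tp"
  shows "flag_h T \<ge> 0"
proof -
  have bttp: "bt < tp" using r rk_bt bt_le[OF tp_in] by (auto simp: le_less)
  have finT: "finite T" using finite_subset[OF T] by simp
  let ?X = "rank_selection bt tp T"
  have finX: "finite ?X" using finite_carrier by (simp add: rank_selection_def)
  have intervals: "acyclic_below {w \<in> P. s < w \<and> w < t} (rk t - rk s - 1)"
    if st: "s \<in> P" "t \<in> P" "s < t" for s t
  proof (rule acyclic_below_if_reduced_homology)
    fix k assume "k < rk t - rk s - 1"
    \<comment> \<open>Dimension \<open>k - 1\<close> stays below \<open>rk t - rk s - 2\<close>, the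
      one degree in which homology may survive.\<close>
    then have "int k - 1 \<noteq> (int (rk t) - int (rk s)) - 2" by linarith
    then show "reduced_homology {w \<in> P. s < w \<and> w < t} (int k - 1) =
        {simplicial_boundaries {w \<in> P. s < w \<and> w < t} (int k - 1)}"
      using cm st unfolding cohen_macaulay_def by blast
  qed (use finite_carrier in simp)
  have "x \<in> {rk bt<..<rk tp}" if "x \<in> T" for x
    using subsetD[OF T that] rk_bt by auto
  then have "acyclic_below ?X (card T)"
    using acyclic_below_rank_selection[OF intervals bt_in tp_in bttp] by blast
  then have "0 \<le> (-1) ^ card T * (\<Sum>C | C \<subseteq> ?X \<and> order_chain C. (-1) ^ card C :: int)"
    by (rule signed_chain_count_nonneg[OF finX]) (rule card_chain_rank_selection[OF finT])
  also have "(\<Sum>C | C \<subseteq> ?X \<and> order_chain C. (-1) ^ card C :: int) =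
      (\<Sum>S\<in>Pow T. \<Sum>C\<in>{C \<in> {C. C \<subseteq> ?X \<and> order_chain C}. rk ` C = S}. (-1) ^ card C)"
    by (rule sum.group[symmetric]) (use finX finT in \<open>auto simp: rank_selection_def\<close>)
  also have "\<dots> = (\<Sum>S\<in>Pow T. (-1) ^ card S * flag_f S)"
  proof (rule sum.cong[OF refl])
    fix S assume S: "S \<in> Pow T"
    have "{C \<in> {C. C \<subseteq> ?X \<and> order_chain C}. rk ` C = S} = {C \<in> proper_chains. rk ` C = S}"
      using S unfolding rank_selection_def proper_chains_def by blast
    moreover have "card C = card S" if C: "C \<in> proper_chains" "rk ` C = S" for C
    proof -
      have "C \<subseteq> P" "order_chain C" using C(1) by (auto simp: proper_chains_def)
      then show ?thesis using card_image[OF inj_on_rk_chain] C(2) by metis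
    qed
    ultimately show "(\<Sum>C\<in>{C \<in> {C. C \<subseteq> ?X \<and> order_chain C}. rk ` C = S}. (-1) ^ card C) =
        (-1) ^ card S * flag_f S"
      by (simp add: flag_f_def mult.commute)
  qed
  finally show ?thesis by (simp add: flag_h_def)
qed

end

theorem theorem4p20:
  fixes P :: "'a::order set" and bt tp :: 'a and rk :: "'a \<Rightarrow> nat" and r :: nat
  assumes "finite_graded_bounded_poset P bt tp rk"
    and "r = rk tp" and "r \<ge> 1"
    and "cohen_macaulay P rk"
  shows "\<exists>\<gamma> :: nat \<Rightarrow> int. (\<forall>i\<in>{0..(r - 1) div 2}. \<gamma> i \<ge> 0) \<and>
    chow_function P rk bt tp =
      (\<Sum>i = 0..(r - 1) div 2. smult (\<gamma> i) (monom 1 i * [:1, 1:] ^ (r - 1 - 2 * i)))"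
proof -
  interpret finite_graded_bounded_poset P bt tp rk by fact
  \<comment> \<open>Without the sets of weight sum zero, the closed form gives one product for each
    remaining set, depending only on its size; grouping by size yields \<gamma>.\<close>
  define R where "R = {T \<in> Pow {1..r - 1}. weight_sum T r \<noteq> 0}"
  define \<gamma> where "\<gamma> i = (\<Sum>T\<in>{T \<in> R. card T = i}. flag_h T)" for i
  have finR: "finite R" by (simp add: R_def)
  have closed: "2 * card T \<le> r - 1 \<and> weight_sum T r = monom 1 (card T) * [:1, 1:] ^ (r - 1 - 2 * card T)"
    if "T \<in> R" for T
  proof -
    have T: "T \<subseteq> {1..r - 1}" "weight_sum T r \<noteq> 0" using that by (auto simp: R_def)
    \<comment> \<open>As \<open>r\<close> is positive and outside \<open>T\<close>, the second case
      of the closed form applies and gives the exponent \<open>r - 1 - 2 * card T\<close>.\<close>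
    have "r \<notin> insert 0 T" using T(1) \<open>r \<ge> 1\<close> by auto
    moreover have "x \<in> {1..r}" if "x \<in> T" for x using subsetD[OF T(1) that] by auto
    then have "T \<inter> {1..r} = T" by blast
    ultimately have "2 * card T < r \<and>
        weight_sum T r = [:0, 1:] ^ card T * [:1, 1:] ^ (r - 1 - 2 * card T)"
      using weight_sum_closed_form[of T r] T(2) by (simp only: if_False simp_thms)
    then show ?thesis by (auto simp: monom_altdef)
  qed
  have "\<gamma> i \<ge> 0" for i
    unfolding \<gamma>_def by (rule sum_nonneg, rule flag_h_nonneg) (use assms in \<open>auto simp: R_def\<close>)
  moreover have "chow_function P rk bt tp =
      (\<Sum>i = 0..(r - 1) div 2. smult (\<gamma> i) (monom 1 i * [:1, 1:] ^ (r - 1 - 2 * i)))"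
  proof -
    have "chow_function P rk bt tp = (\<Sum>T\<in>Pow {1..r - 1}. smult (flag_h T) (weight_sum T r))"
      using chow_function_flag_h assms by simp
    also have "\<dots> = (\<Sum>T\<in>R. smult (flag_h T) (weight_sum T r))"
      by (rule sum.mono_neutral_right) (auto simp: R_def)
    also have "\<dots> = (\<Sum>i\<in>{0..(r - 1) div 2}. \<Sum>T\<in>{T \<in> R. card T = i}. smult (flag_h T) (weight_sum T r))"
      by (rule sum.group[symmetric]) (use finR closed in fastforce)+
    also have "\<dots> = (\<Sum>i = 0..(r - 1) div 2. smult (\<gamma> i) (monom 1 i * [:1, 1:] ^ (r - 1 - 2 * i)))"
      by (rule sum.cong[OF refl]) (simp add: \<gamma>_def smult_sum closed)
    finally show ?thesis .
  qed
  ultimately show ?thesis by blast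
qed

end
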